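(* Let $n,m_1,m_2$ be positive integers with $\gcd(m_1,m_2)=1$ and let $r\ge0$ be an integer. Let $$H=\langle x_1,\dots,x_r,a,b : a^{m_1}=b^{m_2},\ a^{m_1n}=1,\ [a^{m_1},x_i]=1\ \forall i=1,\dots,r\rangle.$$ Then, up to isomorphism, $H$ is the unique group $G$ such that (1) there exists a central extension $1\to\mathbb{Z}_n\to G\to\mathbb{F}_r*\mathbb{Z}_{m_1}*\mathbb{Z}_{m_2}\to1$, and (2) $G/G'\cong\mathbb{Z}_{nm_1m_2}\times\mathbb{Z}^r$, where $G'$ is the commutator subgroup. In particular $H\cong G((r+1)m_1;(r+1)m_2;nm_2)$, and if $\gcd(n,m_1m_2)=1$ then $H\cong\mathbb{Z}_n\times(\mathbb{F}_r*\mathbb{Z}_{m_1}*\mathbb{Z}_{m_2})$.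
   Context: $\mathbb{F}_r$ is the free group of rank $r$. Oka's group: for positive integers $p,q,r$, $G(p;q;r)=\langle \omega, a_i\ (i\in\mathbb{Z}) : \omega=a_{p-1}a_{p-2}\cdots a_0,\ \omega^r=e,\ a_i=a_{i+q}\ \forall i,\ a_{i+p}=\omega a_i\omega^{-1}\ \forall i\rangle$. *)

theory Defs
  imports "HOL-Algebra.Algebra"
begin

text \<open>Words over generators of type 'a: a letter (g, True) stands for g, (g, False) for g inverse.\<close>

fun reduced_word :: "('a \<times> bool) list \<Rightarrow> bool" where
  "reduced_word [] = True"
| "reduced_word [x] = True"
| "reduced_word (x # y # ys) = (\<not> (fst x = fst y \<and> snd x \<noteq> snd y) \<and> reduced_word (y # ys))"

definition free_reduce :: "('a \<times> bool) list \<Rightarrow> ('a \<times> bool) list" where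
  "free_reduce w = foldr (\<lambda>x acc. case acc of [] \<Rightarrow> [x]
       | y # ys \<Rightarrow> (if fst y = fst x \<and> snd y \<noteq> snd x then ys else x # acc)) w []"

definition free_group :: "'a set \<Rightarrow> (('a \<times> bool) list) monoid" where
  "free_group S = \<lparr>carrier = {w. set w \<subseteq> S \<times> UNIV \<and> reduced_word w},
                   monoid.mult = (\<lambda>u v. free_reduce (u @ v)), one = []\<rparr>"

definition normal_closure :: "('a, 'b) monoid_scheme \<Rightarrow> 'a set \<Rightarrow> 'a set" where
  "normal_closure G A = generate G (\<Union>g\<in>carrier G. (\<lambda>a. g \<otimes>\<^bsub>G\<^esub> a \<otimes>\<^bsub>G\<^esub> inv\<^bsub>G\<^esub> g) ` A)"

definition presented_group :: "'a set \<Rightarrow> ('a \<times> bool) list set \<Rightarrow> (('a \<times> bool) list set) monoid" where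
  "presented_group S R = free_group S Mod normal_closure (free_group S) (free_reduce ` R)"

definition wgen :: "'a \<Rightarrow> ('a \<times> bool) list" where "wgen g = [(g, True)]"
definition winv :: "('a \<times> bool) list \<Rightarrow> ('a \<times> bool) list" where
  "winv w = rev (map (\<lambda>(g, b). (g, \<not> b)) w)"
definition wpow :: "('a \<times> bool) list \<Rightarrow> nat \<Rightarrow> ('a \<times> bool) list" where
  "wpow w k = concat (replicate k w)"

datatype hgen = GX nat | GA | GB

text \<open>Generators x_1..x_r (indexed here by 0..r-1), a, b.\<close>
definition hgens :: "nat \<Rightarrow> hgen set" where
  "hgens r = {GX i | i. i < r} \<union> {GA, GB}"

definition H_group :: "nat \<Rightarrow> nat \<Rightarrow> nat \<Rightarrow> nat \<Rightarrow> ((hgen \<times> bool) list set) monoid" where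
  "H_group n m1 m2 r = presented_group (hgens r)
     ({wpow (wgen GA) m1 @ winv (wpow (wgen GB) m2),
       wpow (wgen GA) (m1 * n)}
      \<union> {wpow (wgen GA) m1 @ wgen (GX i) @ winv (wpow (wgen GA) m1) @ winv (wgen (GX i)) | i. i < r})"

text \<open>F_r * Z_m1 * Z_m2 = < x_1..x_r, a, b : a^m1 = 1, b^m2 = 1 >\<close>
definition Q_group :: "nat \<Rightarrow> nat \<Rightarrow> nat \<Rightarrow> ((hgen \<times> bool) list set) monoid" where
  "Q_group m1 m2 r = presented_group (hgens r) {wpow (wgen GA) m1, wpow (wgen GB) m2}"

datatype okagen = Om | OA int

definition oka_group :: "nat \<Rightarrow> nat \<Rightarrow> nat \<Rightarrow> ((okagen \<times> bool) list set) monoid" where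
  "oka_group p q r = presented_group UNIV
     ({winv (wgen Om) @ concat (map (\<lambda>j. wgen (OA (int j))) (rev [0..<p])),
       wpow (wgen Om) r}
      \<union> {wgen (OA i) @ winv (wgen (OA (i + int q))) | i. True}
      \<union> {wgen (OA (i + int p)) @ wgen Om @ winv (wgen (OA i)) @ winv (wgen Om) | i. True})"

definition central_extension ::
  "('n, 'a) monoid_scheme \<Rightarrow> ('g, 'b) monoid_scheme \<Rightarrow> ('q, 'c) monoid_scheme \<Rightarrow> bool" where
  "central_extension N G Q \<longleftrightarrow>
     (\<exists>\<iota> \<pi>. \<iota> \<in> hom N G \<and> inj_on \<iota> (carrier N) \<and>
            \<pi> \<in> hom G Q \<and> \<pi> ` carrier G = carrier Q \<and>
            kernel G Q \<pi> = \<iota> ` carrier N \<and>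
            (\<forall>z\<in>\<iota> ` carrier N. \<forall>g\<in>carrier G. z \<otimes>\<^bsub>G\<^esub> g = g \<otimes>\<^bsub>G\<^esub> z))"

definition abelianization :: "('g, 'b) monoid_scheme \<Rightarrow> ('g set) monoid" where
  "abelianization G = G Mod derived G (carrier G)"

definition Zmod_times_Zr :: "nat \<Rightarrow> nat \<Rightarrow> (int \<times> (nat \<Rightarrow> int)) monoid" where
  "Zmod_times_Zr k r = integer_mod_group k \<times>\<times> product_group {..<r} (\<lambda>_. integer_group)"

end

theory Submission
  imports Defs "HOL-Number_Theory.Cong"
begin

text \<open>
  Sending \<open>a\<close> to \<open>m\<^sub>2\<close>, \<open>b\<close> to \<open>m\<^sub>1\<close> and the \<open>x\<^sub>i\<close> to a basis of \<open>\<int>\<^sup>r\<close> identifies the abelianization of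
  \<open>H\<close> with \<open>\<int>/(n m\<^sub>1 m\<^sub>2) \<times> \<int>\<^sup>r\<close>; hence the central element \<open>a ^ m\<^sub>1\<close> has order exactly \<open>n\<close>, and no
  normal form for free products is needed to see that \<open>H\<close> is a central extension of \<open>Q\<close>.

  A central extension \<open>G\<close> is isomorphic to \<open>H\<close> as soon as \<open>a\<close> and \<open>b\<close> have lifts whose \<open>m\<^sub>1\<close>-th and
  \<open>m\<^sub>2\<close>-th powers are the same generator of \<open>\<int>/n\<close>. If arbitrary lifts have powers \<open>s\<close> and \<open>t\<close>, one
  needs \<open>c\<close> prime to \<open>n\<close> with \<open>c = s\<close> modulo \<open>m\<^sub>1\<close> and \<open>c = t\<close> modulo \<open>m\<^sub>2\<close>. The only obstruction is a
  common divisor \<open>p > 1\<close> of \<open>n\<close> and, say, both \<open>m\<^sub>1\<close> and \<open>s\<close>; then \<open>n m\<^sub>1 m\<^sub>2 / p\<close> kills both lifts and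
  the kernel, so these vanish in \<open>(\<int>/p) ^ (r + 1)\<close>, which would be generated by \<open>r\<close> elements.

  In Oka's group let \<open>R = r + 1\<close>, \<open>p = R m\<^sub>1\<close>, \<open>q = R m\<^sub>2\<close> and let \<open>P(k)\<close> be the product of the \<open>a\<^sub>i\<close> for
  \<open>i\<close> from \<open>k - 1\<close> down to \<open>0\<close>. Then \<open>P(j p)\<close> and \<open>P(j q)\<close> are the \<open>j\<close>-th powers of \<open>\<omega> = P(p)\<close> and
  \<open>\<sigma> = P(q)\<close>, so \<open>\<sigma> ^ m\<^sub>1\<close> equals the central element \<open>\<omega> ^ m\<^sub>2\<close>: the isomorphism is \<open>a \<mapsto> \<sigma>\<close>, \<open>b \<mapsto> \<omega>\<close>,
  \<open>x\<^sub>i \<mapsto> a\<^sub>i\<close>. Conversely \<open>u m\<^sub>1 = w m\<^sub>2 + 1\<close> shows that shifting an index by \<open>R\<close> is conjugation by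
  \<open>\<omega> ^ u\<close> and that \<open>P(R)\<close> is a word in \<open>\<omega>\<close> and \<open>\<sigma>\<close>, so \<open>\<omega>\<close>, \<open>\<sigma>\<close> and \<open>a\<^sub>1, \<dots>, a\<^sub>r\<close> determine all \<open>a\<^sub>i\<close>.
\<close>

section \<open>Centralizers, powers and generators\<close>

context group begin

lemma subgroup_centralizer:
  assumes z: "z \<in> carrier G"
  shows "subgroup {x \<in> carrier G. z \<otimes> x = x \<otimes> z} G"
proof (rule subgroupI)
  fix x assume "x \<in> {x \<in> carrier G. z \<otimes> x = x \<otimes> z}"
  then have x: "x \<in> carrier G" and comm: "z \<otimes> x = x \<otimes> z"
    by simp_all
  have "z \<otimes> inv x = inv x \<otimes> (x \<otimes> z) \<otimes> inv x"
    using x z by (simp flip: m_assoc)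
  also have "\<dots> = inv x \<otimes> z"
    using x z by (simp flip: comm add: m_assoc)
  finally show "inv x \<in> {x \<in> carrier G. z \<otimes> x = x \<otimes> z}"
    using x by simp
next
  fix x y assume "x \<in> {x \<in> carrier G. z \<otimes> x = x \<otimes> z}" "y \<in> {x \<in> carrier G. z \<otimes> x = x \<otimes> z}"
  then have x: "x \<in> carrier G" "z \<otimes> x = x \<otimes> z" and y: "y \<in> carrier G" "z \<otimes> y = y \<otimes> z"
    by simp_all
  then have "z \<otimes> (x \<otimes> y) = x \<otimes> (z \<otimes> y)"
    using z by (metis m_assoc)
  then show "x \<otimes> y \<in> {x \<in> carrier G. z \<otimes> x = x \<otimes> z}"
    using x y z by (simp add: m_assoc)
qed (use z in auto)

lemma commutes_with_generate:
  assumes "z \<in> carrier G" "A \<subseteq> carrier G" "\<And>a. a \<in> A \<Longrightarrow> z \<otimes> a = a \<otimes> z" "x \<in> generate G A"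
  shows "z \<otimes> x = x \<otimes> z"
  using generate_subgroup_incl[OF _ subgroup_centralizer[OF assms(1)], of A] assms(2-) by blast

lemma int_pow_commutes:
  assumes "x \<otimes> y = y \<otimes> x" "x \<in> carrier G" "y \<in> carrier G"
  shows "x [^] (k::int) \<otimes> y = y \<otimes> x [^] k"
  using subgroup_int_pow_closed[OF subgroup_centralizer[OF assms(3)], of x k] assms by simp

lemma normal_range_central_powers:
  assumes z: "z \<in> carrier G" and central: "\<And>x. x \<in> carrier G \<Longrightarrow> z \<otimes> x = x \<otimes> z"
  shows "range (\<lambda>k::int. z [^] k) \<lhd> G"
proof (rule normal_invI[OF subgroup_of_powers[OF z]])
  fix x h assume x: "x \<in> carrier G" and h: "h \<in> range (\<lambda>k::int. z [^] k)"
  then obtain k :: int where k: "h = z [^] k" by blast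
  have "x \<otimes> h = h \<otimes> x"
    using int_pow_commutes[OF central[OF x] z x] by (simp add: k)
  then have "x \<otimes> h \<otimes> inv x = h"
    using x z by (simp add: k m_assoc)
  then show "x \<otimes> h \<otimes> inv x \<in> range (\<lambda>k::int. z [^] k)"
    using h by simp
qed

lemma int_pow_mod:
  assumes "z \<in> carrier G" "z [^] n = \<one>"
  shows "z [^] (k mod int n) = z [^] k"
proof -
  have "int n dvd k - k mod int n"
    by (simp add: minus_mod_eq_mult_div)
  moreover have "int (ord z) dvd int n"
    using assms pow_eq_id by simp
  ultimately show ?thesis
    using assms(1) int_pow_eq dvd_trans by blast
qed

lemma eq_iff_mult_inv_eq_one:
  assumes "x \<in> carrier G" "y \<in> carrier G"
  shows "x \<otimes> inv y = \<one> \<longleftrightarrow> x = y"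
  using assms by (metis inv_closed inv_equality inv_inv r_inv)

end

lemma hom_eq_on_generate:
  assumes "group_hom G K h" "group_hom G K k" and A: "A \<subseteq> carrier G"
    and eq: "\<And>a. a \<in> A \<Longrightarrow> h a = k a" and "x \<in> generate G A"
  shows "h x = k x"
proof -
  interpret h: group_hom G K h by fact
  interpret k: group_hom G K k by fact
  have "g \<in> carrier G" if "g \<in> generate G A" for g
    using that A h.G.generate_in_carrier by blast
  with \<open>x \<in> generate G A\<close> show ?thesis
    by (induction rule: generate.induct) (use A eq in \<open>auto simp: subset_iff\<close>)
qed

lemma group_isomorphisms_if_inverse_on_generators:
  assumes "group_hom G K h" "group_hom K G k"
    and A: "A \<subseteq> carrier G" "carrier G = generate G A" "\<And>a. a \<in> A \<Longrightarrow> k (h a) = a"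
    and B: "B \<subseteq> carrier K" "carrier K = generate K B" "\<And>b. b \<in> B \<Longrightarrow> h (k b) = b"
  shows "group_isomorphisms G K h k"
proof -
  interpret h: group_hom G K h by fact
  interpret k: group_hom K G k by fact
  interpret kh: group_hom G G "k \<circ> h"
    by unfold_locales (rule Group.hom_compose[OF h.homh k.homh])
  interpret hk: group_hom K K "h \<circ> k"
    by unfold_locales (rule Group.hom_compose[OF k.homh h.homh])
  interpret idG: group_hom G G id by unfold_locales (simp add: hom_def)
  interpret idK: group_hom K K id by unfold_locales (simp add: hom_def)
  have "k (h x) = x" if "x \<in> carrier G" for x
    using hom_eq_on_generate[OF kh.group_hom_axioms idG.group_hom_axioms A(1)] A(2,3) that by simp
  moreover have "h (k y) = y" if "y \<in> carrier K" for y
    using hom_eq_on_generate[OF hk.group_hom_axioms idK.group_hom_axioms B(1)] B(2,3) that by simp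
  ultimately show ?thesis
    by (simp add: group_isomorphisms_def)
qed

lemma (in group_hom) kernel_eqI_left_inverse_Mod:
  assumes N: "N \<lhd> G" "N \<subseteq> kernel G H h" and s: "s \<in> hom H (G Mod N)"
    and A: "A \<subseteq> carrier G" "carrier G = generate G A" "\<And>a. a \<in> A \<Longrightarrow> s (h a) = N #> a"
  shows "kernel G H h = N"
proof
  interpret Mod: group "G Mod N" by (rule normal.factorgroup_is_group[OF N(1)])
  interpret proj: group_hom G "G Mod N" "\<lambda>g. N #> g"
    by unfold_locales (rule normal.r_coset_hom_Mod[OF N(1)])
  interpret s: group_hom H "G Mod N" s by unfold_locales (rule s)
  interpret sh: group_hom G "G Mod N" "s \<circ> h"
    by unfold_locales (rule Group.hom_compose[OF homh s])
  show "kernel G H h \<subseteq> N"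
  proof
    fix g assume "g \<in> kernel G H h"
    then have g: "g \<in> carrier G" "h g = \<one>\<^bsub>H\<^esub>" by (simp_all add: kernel_def)
    have "N #> g = s (h g)"
      using hom_eq_on_generate[OF sh.group_hom_axioms proj.group_hom_axioms A(1)] A(2,3) g(1) by simp
    also have "\<dots> = N" using g(2) by simp
    finally show "g \<in> N"
      using G.rcos_self[OF g(1) normal_imp_subgroup[OF N(1)]] by simp
  qed
qed (rule N(2))

section \<open>Free groups and presentations\<close>

definition red_step :: "'a \<times> bool \<Rightarrow> ('a \<times> bool) list \<Rightarrow> ('a \<times> bool) list" where
  "red_step x acc = (case acc of [] \<Rightarrow> [x]
     | y # ys \<Rightarrow> (if fst y = fst x \<and> snd y \<noteq> snd x then ys else x # acc))"

lemma free_reduce_eq_foldr: "free_reduce w = foldr red_step w []"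
  unfolding free_reduce_def red_step_def by (rule refl)

lemma free_reduce_Nil [simp]: "free_reduce [] = []"
  by (simp add: free_reduce_eq_foldr)

lemma free_reduce_Cons: "free_reduce (x # w) = red_step x (free_reduce w)"
  by (simp add: free_reduce_eq_foldr)

lemma free_reduce_append: "free_reduce (u @ v) = foldr red_step u (free_reduce v)"
  by (simp add: free_reduce_eq_foldr)

lemma reduced_word_ConsD: "reduced_word (x # w) \<Longrightarrow> reduced_word w"
  by (cases w) auto

lemma reduced_word_red_step: "reduced_word w \<Longrightarrow> reduced_word (red_step x w)"
  by (cases w) (auto simp: red_step_def dest: reduced_word_ConsD)

lemma reduced_word_foldr_red_step: "reduced_word w \<Longrightarrow> reduced_word (foldr red_step u w)"
  by (induction u) (auto intro: reduced_word_red_step)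

lemma reduced_word_free_reduce: "reduced_word (free_reduce w)"
  by (simp add: free_reduce_eq_foldr reduced_word_foldr_red_step)

lemma free_reduce_reduced: "reduced_word w \<Longrightarrow> free_reduce w = w"
proof (induction w)
  case (Cons x w)
  then show ?case
    by (cases w) (auto simp: free_reduce_Cons red_step_def)
qed simp

lemma set_free_reduce: "set (free_reduce w) \<subseteq> set w"
proof (induction w)
  case (Cons x w)
  then show ?case
    by (auto simp: free_reduce_Cons red_step_def split: list.splits if_splits)
qed simp

lemma red_step_cancel:
  assumes "reduced_word w" "fst y = fst x" "snd y \<noteq> snd x"
  shows "red_step x (red_step y w) = w"
proof (cases w)
  case (Cons z zs)
  with assms show ?thesis
    by (cases x; cases y; cases z; cases zs) (auto simp: red_step_def)
qed (use assms in \<open>auto simp: red_step_def\<close>)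

lemma foldr_red_step_red_step:
  assumes "reduced_word w"
  shows "foldr red_step (red_step x l) w = red_step x (foldr red_step l w)"
proof (cases l)
  case (Cons y ys)
  then show ?thesis
    using red_step_cancel[OF reduced_word_foldr_red_step[OF assms], of y x ys]
    by (auto simp: red_step_def)
qed (simp add: red_step_def)

lemma foldr_red_step_free_reduce:
  assumes "reduced_word w"
  shows "foldr red_step (free_reduce u) w = foldr red_step u w"
  by (induction u) (simp_all add: free_reduce_Cons foldr_red_step_red_step assms)

lemma free_reduce_append_left: "free_reduce (free_reduce u @ v) = free_reduce (u @ v)"
  by (simp add: free_reduce_append foldr_red_step_free_reduce reduced_word_free_reduce)

lemma free_reduce_append_right: "free_reduce (u @ free_reduce v) = free_reduce (u @ v)"
  by (simp add: free_reduce_append free_reduce_reduced reduced_word_free_reduce)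

lemma winv_Nil [simp]: "winv [] = []"
  by (simp add: winv_def)

lemma winv_Cons: "winv (x # w) = winv w @ [(fst x, \<not> snd x)]"
  by (simp add: winv_def case_prod_beta)

lemma set_winv: "set w \<subseteq> S \<times> UNIV \<Longrightarrow> set (winv w) \<subseteq> S \<times> UNIV"
  by (auto simp: winv_def)

lemma free_reduce_winv: "free_reduce (winv w @ w) = []"
proof (induction w)
  case (Cons x w)
  have "free_reduce (winv (x # w) @ x # w)
      = foldr red_step (winv w) (red_step (fst x, \<not> snd x) (red_step x (free_reduce w)))"
    by (simp add: winv_Cons free_reduce_append free_reduce_Cons)
  also have "\<dots> = foldr red_step (winv w) (free_reduce w)"
    by (simp add: red_step_cancel reduced_word_free_reduce)
  finally show ?case
    using Cons by (simp add: free_reduce_append)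
qed simp

lemma carrier_free_group: "carrier (free_group S) = {w. set w \<subseteq> S \<times> UNIV \<and> reduced_word w}"
  by (simp add: free_group_def)

lemma mult_free_group: "u \<otimes>\<^bsub>free_group S\<^esub> v = free_reduce (u @ v)"
  by (simp add: free_group_def)

lemma one_free_group: "\<one>\<^bsub>free_group S\<^esub> = []"
  by (simp add: free_group_def)

lemma free_reduce_in_carrier:
  "set w \<subseteq> S \<times> UNIV \<Longrightarrow> free_reduce w \<in> carrier (free_group S)"
  using set_free_reduce[of w] by (auto simp: carrier_free_group reduced_word_free_reduce)

lemma group_free_group: "group (free_group S)"
proof (rule groupI)
  fix u v assume "u \<in> carrier (free_group S)" "v \<in> carrier (free_group S)"
  then show "u \<otimes>\<^bsub>free_group S\<^esub> v \<in> carrier (free_group S)"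
    unfolding mult_free_group by (intro free_reduce_in_carrier) (auto simp: carrier_free_group)
next
  fix u assume u: "u \<in> carrier (free_group S)"
  then have "free_reduce (winv u) \<in> carrier (free_group S)"
    by (intro free_reduce_in_carrier set_winv) (simp add: carrier_free_group)
  then show "\<exists>v\<in>carrier (free_group S). v \<otimes>\<^bsub>free_group S\<^esub> u = \<one>\<^bsub>free_group S\<^esub>"
    by (intro bexI[of _ "free_reduce (winv u)"])
      (simp add: mult_free_group one_free_group free_reduce_append_left free_reduce_winv)
qed (auto simp: mult_free_group one_free_group carrier_free_group free_reduce_append_left
    free_reduce_append_right free_reduce_reduced)

fun weval :: "('g, 'c) monoid_scheme \<Rightarrow> ('a \<Rightarrow> 'g) \<Rightarrow> ('a \<times> bool) list \<Rightarrow> 'g" where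
  "weval G f [] = \<one>\<^bsub>G\<^esub>"
| "weval G f (x # w) = (if snd x then f (fst x) else inv\<^bsub>G\<^esub> f (fst x)) \<otimes>\<^bsub>G\<^esub> weval G f w"

context group begin

lemma weval_closed:
  assumes "f ` S \<subseteq> carrier G" "set w \<subseteq> S \<times> UNIV"
  shows "weval G f w \<in> carrier G"
  using assms(2)
proof (induction w)
  case (Cons x w)
  then have "f (fst x) \<in> carrier G" using assms(1) by auto
  with Cons show ?case by auto
qed simp

lemma weval_append:
  assumes "f ` S \<subseteq> carrier G" "set u \<subseteq> S \<times> UNIV" "set v \<subseteq> S \<times> UNIV"
  shows "weval G f (u @ v) = weval G f u \<otimes> weval G f v"
  using assms(2)
proof (induction u)
  case Nil
  then show ?case using weval_closed[OF assms(1,3)] by simp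
next
  case (Cons x u)
  then have "f (fst x) \<in> carrier G" using assms(1) by auto
  with Cons show ?case
    using weval_closed[OF assms(1), of u] weval_closed[OF assms(1,3)] by (auto simp: m_assoc)
qed

lemma weval_free_reduce:
  assumes f: "f ` S \<subseteq> carrier G" and "set w \<subseteq> S \<times> UNIV"
  shows "weval G f (free_reduce w) = weval G f w"
  using assms(2)
proof (induction w)
  case (Cons x w)
  have x: "f (fst x) \<in> carrier G" and w: "set w \<subseteq> S \<times> UNIV"
    using Cons.prems f by auto
  have IH: "weval G f (free_reduce w) = weval G f w"
    using Cons.IH w .
  show ?case
  proof (cases "free_reduce w")
    case Nil
    then show ?thesis using IH by (simp add: free_reduce_Cons red_step_def)
  next
    case (Cons y ys)
    have "set ys \<subseteq> S \<times> UNIV"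
      using set_free_reduce[of w] w Cons by auto
    then have ys: "weval G f ys \<in> carrier G"
      by (rule weval_closed[OF f])
    show ?thesis
    proof (cases "fst y = fst x \<and> snd y \<noteq> snd x")
      case True
      then have "weval G f (x # w) = weval G f ys"
        using IH[symmetric] Cons x ys by (auto simp: m_assoc[symmetric])
      then show ?thesis using True Cons by (simp add: free_reduce_Cons red_step_def)
    next
      case False
      then have "free_reduce (x # w) = x # free_reduce w"
        using Cons by (auto simp: free_reduce_Cons red_step_def)
      then show ?thesis using IH by simp
    qed
  qed
qed simp

lemma weval_wgen: "f g \<in> carrier G \<Longrightarrow> weval G f (wgen g) = f g"
  by (simp add: wgen_def)

lemma weval_winv:
  assumes f: "f ` S \<subseteq> carrier G" and "set w \<subseteq> S \<times> UNIV"
  shows "weval G f (winv w) = inv (weval G f w)"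
  using assms(2)
proof (induction w)
  case (Cons x w)
  have x: "f (fst x) \<in> carrier G" "fst x \<in> S" and w: "set w \<subseteq> S \<times> UNIV"
    using Cons.prems f by auto
  have "weval G f (winv (x # w)) = weval G f (winv w) \<otimes> weval G f [(fst x, \<not> snd x)]"
    unfolding winv_Cons by (rule weval_append[OF f set_winv[OF w]]) (use x in auto)
  then show ?case
    using Cons.IH[OF w] x weval_closed[OF f w] by (auto simp: inv_mult_group)
qed simp

lemma weval_wpow:
  assumes f: "f ` S \<subseteq> carrier G" and w: "set w \<subseteq> S \<times> UNIV"
  shows "weval G f (wpow w k) = weval G f w [^] k"
proof (induction k)
  case (Suc k)
  have "wpow w (Suc k) = w @ wpow w k" by (simp add: wpow_def)
  moreover have "set (wpow w k) \<subseteq> S \<times> UNIV" using w by (auto simp: wpow_def)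
  ultimately show ?case
    using Suc weval_append[OF f w] weval_closed[OF f w] by (simp flip: nat_pow_Suc2)
qed (simp add: wpow_def)

lemma weval_in_generate:
  assumes "set w \<subseteq> S \<times> UNIV"
  shows "weval G f w \<in> generate G (f ` S)"
  using assms
  by (induction w) (auto intro!: generate.one generate.eng intro: generate.incl generate.inv)

lemma weval_hom_free_group:
  assumes "f ` S \<subseteq> carrier G"
  shows "weval G f \<in> hom (free_group S) G"
proof (rule homI)
  fix u v assume "u \<in> carrier (free_group S)" "v \<in> carrier (free_group S)"
  then show "weval G f (u \<otimes>\<^bsub>free_group S\<^esub> v) = weval G f u \<otimes> weval G f v"
    by (simp add: carrier_free_group mult_free_group
        weval_free_reduce[OF assms] weval_append[OF assms])
qed (simp add: carrier_free_group weval_closed[OF assms])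

end
lemma (in group_hom) hom_weval:
  assumes f: "f ` S \<subseteq> carrier G" and "set w \<subseteq> S \<times> UNIV"
  shows "h (weval G f w) = weval H (h \<circ> f) w"
  using assms(2)
proof (induction w)
  case (Cons x w)
  then have "f (fst x) \<in> carrier G" "weval G f w \<in> carrier G"
    using f G.weval_closed[OF f] by auto
  with Cons show ?case by simp
qed simp

locale presentation =
  fixes G (structure) and S :: "'a set" and R :: "('a \<times> bool) list set"
  assumes presented: "G = presented_group S R"
    and relators: "\<And>w. w \<in> R \<Longrightarrow> set w \<subseteq> S \<times> UNIV"
begin

abbreviation F :: "('a \<times> bool) list monoid" where
  "F \<equiv> free_group S"

abbreviation N :: "('a \<times> bool) list set" where
  "N \<equiv> normal_closure F (free_reduce ` R)"

definition gen :: "'a \<Rightarrow> ('a \<times> bool) list set" where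
  "gen s = N #>\<^bsub>F\<^esub> [(s, True)]"

sublocale F: group F by (rule group_free_group)

lemma free_reduce_relators: "free_reduce ` R \<subseteq> carrier F"
  using relators free_reduce_in_carrier by blast

lemma normal_N: "N \<lhd> F"
  unfolding normal_closure_def
proof (rule F.normal_generateI)
  let ?C = "\<Union>g\<in>carrier F. (\<lambda>a. g \<otimes>\<^bsub>F\<^esub> a \<otimes>\<^bsub>F\<^esub> inv\<^bsub>F\<^esub> g) ` free_reduce ` R"
  show "?C \<subseteq> carrier F"
    using free_reduce_relators by blast
  fix h g assume "h \<in> ?C" and g: "g \<in> carrier F"
  then obtain k a where k: "k \<in> carrier F" "a \<in> free_reduce ` R" "h = k \<otimes>\<^bsub>F\<^esub> a \<otimes>\<^bsub>F\<^esub> inv\<^bsub>F\<^esub> k"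
    by blast
  then have "a \<in> carrier F" using free_reduce_relators by blast
  then have "g \<otimes>\<^bsub>F\<^esub> h \<otimes>\<^bsub>F\<^esub> inv\<^bsub>F\<^esub> g = (g \<otimes>\<^bsub>F\<^esub> k) \<otimes>\<^bsub>F\<^esub> a \<otimes>\<^bsub>F\<^esub> inv\<^bsub>F\<^esub> (g \<otimes>\<^bsub>F\<^esub> k)"
    using k g by (simp add: F.inv_mult_group F.m_assoc)
  then show "g \<otimes>\<^bsub>F\<^esub> h \<otimes>\<^bsub>F\<^esub> inv\<^bsub>F\<^esub> g \<in> ?C"
    using k g by blast
qed

lemma presented_Mod: "G = F Mod N"
  using presented by (simp add: presented_group_def)

sublocale group G
  unfolding presented_Mod by (rule normal.factorgroup_is_group[OF normal_N])

sublocale coset: group_hom F G "\<lambda>w. N #>\<^bsub>F\<^esub> w"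
proof unfold_locales
  show "(\<lambda>w. N #>\<^bsub>F\<^esub> w) \<in> hom F G"
    unfolding presented_Mod by (rule normal.r_coset_hom_Mod[OF normal_N])
qed

lemma gen_closed [simp]: "s \<in> S \<Longrightarrow> gen s \<in> carrier G"
  unfolding gen_def by (rule coset.hom_closed) (simp add: carrier_free_group)

lemma gen_image_closed: "gen ` S \<subseteq> carrier G"
  by auto

lemma weval_free_group:
  assumes "set w \<subseteq> S \<times> UNIV"
  shows "weval F (\<lambda>s. [(s, True)]) w = free_reduce w"
  using assms
proof (induction w)
  case (Cons x w)
  have "inv\<^bsub>F\<^esub> [(fst x, True)] = [(fst x, False)]"
    using Cons.prems by (intro F.inv_equality)
      (auto simp: carrier_free_group mult_free_group one_free_group free_reduce_Cons red_step_def)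
  then have "weval F (\<lambda>s. [(s, True)]) (x # w) = [x] \<otimes>\<^bsub>F\<^esub> free_reduce w"
    using Cons by (cases x) auto
  then show ?case
    by (simp add: mult_free_group free_reduce_append_right[of "[x]", simplified])
qed (simp add: one_free_group)

lemma weval_gen:
  assumes "set w \<subseteq> S \<times> UNIV"
  shows "weval G gen w = N #>\<^bsub>F\<^esub> free_reduce w"
  using coset.hom_weval[of "\<lambda>s. [(s, True)]" S w] assms
  by (simp add: weval_free_group carrier_free_group comp_def image_subset_iff gen_def[abs_def])

lemma weval_relator:
  assumes "w \<in> R"
  shows "weval G gen w = \<one>"
proof -
  let ?w = "free_reduce w"
  have w: "?w \<in> carrier F" using free_reduce_relators assms by blast
  then have "?w = \<one>\<^bsub>F\<^esub> \<otimes>\<^bsub>F\<^esub> ?w \<otimes>\<^bsub>F\<^esub> inv\<^bsub>F\<^esub> \<one>\<^bsub>F\<^esub>" by simp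
  then have "?w \<in> N"
    unfolding normal_closure_def using assms by (intro generate.incl UN_I[OF F.one_closed]) blast
  then have "N #>\<^bsub>F\<^esub> ?w = N"
    using F.coset_join2 w normal_imp_subgroup[OF normal_N] by blast
  then show ?thesis
    using weval_gen[OF relators[OF assms]] by (simp add: presented_Mod)
qed

lemma carrier_eq_generate: "carrier G = generate G (gen ` S)"
proof
  show "carrier G \<subseteq> generate G (gen ` S)"
  proof
    fix x assume "x \<in> carrier G"
    then obtain w where w: "w \<in> carrier F" "x = N #>\<^bsub>F\<^esub> w"
      by (auto simp: presented_Mod carrier_FactGroup)
    then have "set w \<subseteq> S \<times> UNIV" "x = weval G gen w"
      by (simp_all add: weval_gen carrier_free_group free_reduce_reduced)
    then show "x \<in> generate G (gen ` S)"
      using weval_in_generate by simp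
  qed
qed (rule generate_incl[OF gen_image_closed])

lemma hom_eqI:
  assumes "group_hom G K h" "group_hom G K k" "\<And>s. s \<in> S \<Longrightarrow> h (gen s) = k (gen s)" "x \<in> carrier G"
  shows "h x = k x"
  using hom_eq_on_generate[OF assms(1,2) gen_image_closed, of x] assms(3,4) carrier_eq_generate by auto

theorem von_Dyck:
  assumes K: "group K" and f: "f ` S \<subseteq> carrier K"
    and rel: "\<And>w. w \<in> R \<Longrightarrow> weval K f w = \<one>\<^bsub>K\<^esub>"
  obtains h where "group_hom G K h" "\<And>s. s \<in> S \<Longrightarrow> h (gen s) = f s"
proof -
  interpret K: group K by fact
  interpret weval: group_hom F K "weval K f"
    by unfold_locales (rule K.weval_hom_free_group[OF f])
  have "free_reduce ` R \<subseteq> kernel F K (weval K f)"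
    using free_reduce_relators rel K.weval_free_reduce[OF f relators] by (auto simp: kernel_def)
  then have "N \<subseteq> kernel F K (weval K f)"
    unfolding normal_closure_def
    by (intro F.generate_subgroup_incl weval.subgroup_kernel)
      (auto simp: normal.inv_op_closed2[OF weval.normal_kernel])
  then obtain h where h: "h \<in> hom G K" "\<And>x. x \<in> carrier F \<Longrightarrow> h (N #>\<^bsub>F\<^esub> x) = weval K f x"
    using weval.FactGroup_universal_kernel[OF normal_N] unfolding presented_Mod by blast
  show thesis
  proof
    show "group_hom G K h" by unfold_locales (rule h(1))
    show "h (gen s) = f s" if "s \<in> S" for s
      using that h(2)[of "[(s, True)]"] f by (auto simp: gen_def carrier_free_group)
  qed
qed

end

section \<open>Abelianization\<close>

lemma (in group_hom) derived_subset_kernel: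
  assumes "comm_group H"
  shows "derived G (carrier G) \<subseteq> kernel G H h"
proof -
  have "h ` derived G (carrier G) = derived H (h ` carrier G)"
    using derived_img by simp
  also have "\<dots> = {\<one>\<^bsub>H\<^esub>}"
    by (rule comm_group.derived_eq_singleton[OF assms]) auto
  finally show ?thesis
    using G.derived_in_carrier[of "carrier G"] by (auto simp: kernel_def)
qed

context group begin

lemma comm_group_abelianization: "comm_group (abelianization G)"
  unfolding abelianization_def by (rule derived_quot_is_comm_group)

lemma group_hom_abelianization:
  "group_hom G (abelianization G) (\<lambda>g. derived G (carrier G) #> g)"
proof -
  interpret ab: comm_group "abelianization G" by (rule comm_group_abelianization)
  show ?thesis
    by unfold_locales
      (simp add: abelianization_def normal.r_coset_hom_Mod[OF derived_self_is_normal])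
qed

lemma abelianization_iso_imp_surj_hom:
  assumes "group T" "abelianization G \<cong> T"
  obtains \<phi> where "group_hom G T \<phi>" "\<phi> ` carrier G = carrier T"
proof -
  interpret T: group T by fact
  interpret proj: group_hom G "abelianization G" "\<lambda>g. derived G (carrier G) #> g"
    by (rule group_hom_abelianization)
  obtain h where h: "h \<in> hom (abelianization G) T" "h ` carrier (abelianization G) = carrier T"
    using assms(2) by (auto simp: is_iso_def iso_def bij_betw_def)
  let ?\<phi> = "h \<circ> (\<lambda>g. derived G (carrier G) #> g)"
  have "group_hom G T ?\<phi>"
    by unfold_locales (rule Group.hom_compose[OF proj.homh h(1)])
  moreover have "?\<phi> ` carrier G = carrier T"
    using h(2) by (simp add: abelianization_def carrier_FactGroup image_comp)
  ultimately show thesis by (rule that)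
qed

end

lemma (in group_hom) abelianization_isoI:
  assumes "comm_group H" "h ` carrier G = carrier H"
    and A: "A \<subseteq> carrier G" "carrier G = generate G A"
    and \<psi>: "\<psi> \<in> hom H (abelianization G)" "\<And>a. a \<in> A \<Longrightarrow> \<psi> (h a) = derived G (carrier G) #> a"
  shows "abelianization G \<cong> H"
proof -
  have "kernel G H h = derived G (carrier G)"
    using kernel_eqI_left_inverse_Mod[OF G.derived_self_is_normal
        derived_subset_kernel[OF assms(1)] _ A] \<psi>
    unfolding abelianization_def by blast
  then show ?thesis
    using FactGroup_iso[OF assms(2)] by (simp add: abelianization_def)
qed

section \<open>Abelian groups\<close>

context comm_group begin

lemma bezout_common_root:
  fixes p q u v :: int
  assumes "a \<in> carrier G" "b \<in> carrier G" "a [^] p = b [^] q" "u * q + v * p = 1"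
  shows "(a [^] u \<otimes> b [^] v) [^] q = a" "(a [^] u \<otimes> b [^] v) [^] p = b"
proof -
  have "(a [^] u \<otimes> b [^] v) [^] q = a [^] (u * q) \<otimes> (b [^] q) [^] v"
    using assms(1,2) by (simp add: int_pow_distrib int_pow_pow mult.commute)
  also have "(b [^] q) [^] v = a [^] (v * p)"
    using assms(1,2) by (simp add: int_pow_pow mult.commute flip: assms(3))
  also have "a [^] (u * q) \<otimes> a [^] (v * p) = a [^] (u * q + v * p)"
    using assms(1,2) by (simp add: int_pow_mult)
  finally show "(a [^] u \<otimes> b [^] v) [^] q = a"
    using assms(1,4) by simp
  have "(a [^] u \<otimes> b [^] v) [^] p = (a [^] p) [^] u \<otimes> b [^] (v * p)"
    using assms(1,2) by (simp add: int_pow_distrib int_pow_pow mult.commute)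
  also have "(a [^] p) [^] u = b [^] (u * q)"
    using assms(1,2) by (simp add: int_pow_pow mult.commute assms(3))
  also have "b [^] (u * q) \<otimes> b [^] (v * p) = b [^] (u * q + v * p)"
    using assms(1,2) by (simp add: int_pow_mult)
  finally show "(a [^] u \<otimes> b [^] v) [^] p = b"
    using assms(2,4) by simp
qed

definition monomial :: "'i set \<Rightarrow> ('i \<Rightarrow> 'a) \<Rightarrow> ('i \<Rightarrow> int) \<Rightarrow> 'a" where
  "monomial I \<xi> c = (\<Otimes>i\<in>I. \<xi> i [^] c i)"

context
  fixes I :: "'i set" and \<xi> :: "'i \<Rightarrow> 'a"
  assumes \<xi>: "\<xi> \<in> I \<rightarrow> carrier G"
begin

lemma int_pow_family: "(\<lambda>i. \<xi> i [^] (c i :: int)) \<in> I \<rightarrow> carrier G"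
  using \<xi> by auto

lemma monomial_closed [simp]: "monomial I \<xi> c \<in> carrier G"
  unfolding monomial_def by (rule finprod_closed[OF int_pow_family])

lemma monomial_cong:
  assumes "\<And>i. i \<in> I \<Longrightarrow> \<xi> i [^] c i = \<xi> i [^] d i"
  shows "monomial I \<xi> c = monomial I \<xi> d"
  unfolding monomial_def by (rule finprod_cong'[OF refl int_pow_family assms])

lemma monomial_add: "monomial I \<xi> c \<otimes> monomial I \<xi> d = monomial I \<xi> (\<lambda>i. c i + d i)"
proof -
  have "monomial I \<xi> (\<lambda>i. c i + d i) = (\<Otimes>i\<in>I. \<xi> i [^] c i \<otimes> \<xi> i [^] d i)"
    unfolding monomial_def using \<xi> by (intro finprod_cong') (auto simp: int_pow_mult Pi_iff)
  then show ?thesis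
    by (simp add: monomial_def finprod_multf int_pow_family)
qed

lemma monomial_zero: "(\<And>i. i \<in> I \<Longrightarrow> c i = 0) \<Longrightarrow> monomial I \<xi> c = \<one>"
  unfolding monomial_def by (rule finprod_one_eqI) simp

lemma monomial_single:
  assumes "finite I" "j \<in> I" "c j = 1" "\<And>i. i \<in> I - {j} \<Longrightarrow> c i = 0"
  shows "monomial I \<xi> c = \<xi> j"
proof -
  have "monomial I \<xi> c = (\<Otimes>i\<in>I. if i = j then \<xi> i else \<one>)"
    unfolding monomial_def using \<xi> assms(2-4) by (intro finprod_cong') (auto simp: Pi_iff)
  then show ?thesis
    using assms(1,2) \<xi> by (simp add: finprod_singleton_swap)
qed

lemma subgroup_monomials: "subgroup (range (monomial I \<xi>)) G"
proof (rule subgroupI)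
  fix x assume "x \<in> range (monomial I \<xi>)"
  then obtain c where c: "x = monomial I \<xi> c" by blast
  have "monomial I \<xi> (\<lambda>i. - c i) \<otimes> x = \<one>"
    unfolding c monomial_add by (rule monomial_zero) simp
  then show "inv x \<in> range (monomial I \<xi>)"
    using inv_equality c by auto
qed (auto simp: monomial_add)

lemma generate_eq_monomials:
  assumes "finite I"
  shows "generate G (\<xi> ` I) = range (monomial I \<xi>)"
proof
  have "\<xi> j = monomial I \<xi> (\<lambda>i. if i = j then 1 else 0)" if "j \<in> I" for j
    by (rule monomial_single[symmetric]) (use assms that in auto)
  then show "generate G (\<xi> ` I) \<subseteq> range (monomial I \<xi>)"
    by (intro generate_subgroup_incl[OF _ subgroup_monomials]) blast
  have \<xi>I: "\<xi> ` I \<subseteq> carrier G" using \<xi> by auto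
  have "monomial J \<xi> c \<in> generate G (\<xi> ` I)" if "finite J" "J \<subseteq> I" for J c
    using that
  proof (induction J)
    case empty
    then show ?case by (simp add: monomial_def generate.one)
  next
    case (insert j J)
    have "\<xi> j [^] c j \<in> generate G (\<xi> ` I)"
      using insert.prems
      by (intro subgroup_int_pow_closed[OF generate_is_subgroup[OF \<xi>I]] generate.incl) auto
    moreover have "monomial (insert j J) \<xi> c = \<xi> j [^] c j \<otimes> monomial J \<xi> c"
      unfolding monomial_def using insert \<xi> by (intro finprod_insert) auto
    ultimately show ?case
      using insert by (simp add: generate.eng)
  qed
  then show "range (monomial I \<xi>) \<subseteq> generate G (\<xi> ` I)"
    using assms by blast
qed

lemma card_generate_exponent_le:
  assumes "finite I" "p > 0" and exponent: "\<And>i. i \<in> I \<Longrightarrow> \<xi> i [^] (p::nat) = \<one>"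
  shows "card (generate G (\<xi> ` I)) \<le> p ^ card I"
proof -
  let ?E = "I \<rightarrow>\<^sub>E {0..<int p}"
  have "monomial I \<xi> c = monomial I \<xi> (\<lambda>i\<in>I. c i mod int p)" for c
    using \<xi> exponent by (intro monomial_cong) (auto simp: int_pow_mod Pi_iff)
  moreover have "(\<lambda>i\<in>I. c i mod int p) \<in> ?E" for c
    using \<open>p > 0\<close> by auto
  ultimately have "generate G (\<xi> ` I) \<subseteq> monomial I \<xi> ` ?E"
    unfolding generate_eq_monomials[OF \<open>finite I\<close>] by blast
  then have "card (generate G (\<xi> ` I)) \<le> card ?E"
    using \<open>finite I\<close> by (meson surj_card_le finite_PiE finite_atLeastLessThan_int)
  then show ?thesis
    by (simp add: card_PiE \<open>finite I\<close>)
qed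

end

end

section \<open>The group \<open>\<int>/k \<times> \<int>\<^sup>r\<close>\<close>

lemma carrier_Zmod_times_Zr:
  "carrier (Zmod_times_Zr k r) = carrier (integer_mod_group k) \<times> ({..<r} \<rightarrow>\<^sub>E UNIV)"
  by (simp add: Zmod_times_Zr_def)

lemma mult_Zmod_times_Zr:
  "x \<otimes>\<^bsub>Zmod_times_Zr k r\<^esub> y = ((fst x + fst y) mod int k, \<lambda>i\<in>{..<r}. snd x i + snd y i)"
  by (simp add: Zmod_times_Zr_def mult_DirProd')

lemma one_Zmod_times_Zr: "\<one>\<^bsub>Zmod_times_Zr k r\<^esub> = (0, \<lambda>i\<in>{..<r}. 0)"
  by (simp add: Zmod_times_Zr_def)

lemma comm_group_Zmod_times_Zr: "comm_group (Zmod_times_Zr k r)"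
proof (rule group.group_comm_groupI)
  show "group (Zmod_times_Zr k r)"
    unfolding Zmod_times_Zr_def by (intro DirProd_group product_group) auto
qed (simp add: mult_Zmod_times_Zr ac_simps)

interpretation Zmod_times_Zr: comm_group "Zmod_times_Zr k r" for k r
  by (rule comm_group_Zmod_times_Zr)

lemma fst_hom_Zmod_times_Zr: "fst \<in> hom (Zmod_times_Zr k r) (integer_mod_group k)"
  by (rule homI) (simp_all add: carrier_Zmod_times_Zr mult_Zmod_times_Zr mem_Times_iff)

lemma coordinate_hom_Zmod_times_Zr: "i < r \<Longrightarrow> (\<lambda>x. snd x i) \<in> hom (Zmod_times_Zr k r) integer_group"
  by (rule homI) (simp_all add: mult_Zmod_times_Zr)

lemma int_pow_Zmod_times_Zr:
  assumes x: "x \<in> carrier (Zmod_times_Zr k r)"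
  shows "x [^]\<^bsub>Zmod_times_Zr k r\<^esub> (m::int) = (m * fst x mod int k, \<lambda>i\<in>{..<r}. m * snd x i)"
    (is "?y = _")
proof (rule prod_eqI)
  show "fst ?y = fst (m * fst x mod int k, \<lambda>i\<in>{..<r}. m * snd x i)"
    using hom_int_pow[OF fst_hom_Zmod_times_Zr x] by (simp add: int_pow_integer_mod_group)
  have "snd ?y \<in> {..<r} \<rightarrow>\<^sub>E UNIV"
    using Zmod_times_Zr.int_pow_closed[OF x, of m] by (simp add: carrier_Zmod_times_Zr mem_Times_iff)
  moreover have "(\<lambda>i\<in>{..<r}. m * snd x i) \<in> {..<r} \<rightarrow>\<^sub>E UNIV"
    by simp
  moreover have "snd ?y i = (\<lambda>i\<in>{..<r}. m * snd x i) i" if "i \<in> {..<r}" for i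
    using hom_int_pow[OF coordinate_hom_Zmod_times_Zr x, of i] that by simp
  ultimately have "snd ?y = (\<lambda>i\<in>{..<r}. m * snd x i)"
    by (rule PiE_ext)
  then show "snd ?y = snd (m * fst x mod int k, \<lambda>i\<in>{..<r}. m * snd x i)"
    by simp
qed

definition torsion_gen :: "nat \<Rightarrow> nat \<Rightarrow> int \<times> (nat \<Rightarrow> int)" where
  "torsion_gen k r = (1 mod int k, \<lambda>i\<in>{..<r}. 0)"

definition free_gen :: "nat \<Rightarrow> nat \<Rightarrow> int \<times> (nat \<Rightarrow> int)" where
  "free_gen r j = (0, \<lambda>i\<in>{..<r}. if i = j then 1 else 0)"

lemma torsion_gen_closed [simp]: "torsion_gen k r \<in> carrier (Zmod_times_Zr k r)"
  by (auto simp: torsion_gen_def carrier_Zmod_times_Zr carrier_integer_mod_group)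

lemma free_gen_closed [simp]: "free_gen r j \<in> carrier (Zmod_times_Zr k r)"
  by (simp add: free_gen_def carrier_Zmod_times_Zr)

lemma int_pow_torsion_gen:
  "torsion_gen k r [^]\<^bsub>Zmod_times_Zr k r\<^esub> (m::int) = (m mod int k, \<lambda>i\<in>{..<r}. 0)"
  by (simp add: int_pow_Zmod_times_Zr) (simp add: torsion_gen_def mod_simps cong: restrict_cong)

lemma int_pow_free_gen:
  "free_gen r j [^]\<^bsub>Zmod_times_Zr k r\<^esub> (m::int) = (0, \<lambda>i\<in>{..<r}. if i = j then m else 0)"
  by (simp add: int_pow_Zmod_times_Zr) (auto simp: free_gen_def cong: restrict_cong)

lemma ord_torsion_gen: "Zmod_times_Zr.ord k r (torsion_gen k r) = k"
proof -
  have "torsion_gen k r [^]\<^bsub>Zmod_times_Zr k r\<^esub> m = \<one>\<^bsub>Zmod_times_Zr k r\<^esub> \<longleftrightarrow> k dvd m" for m :: nat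
    using int_pow_torsion_gen[of k r "int m"]
    by (simp add: int_pow_int one_Zmod_times_Zr mod_eq_0_iff_dvd)
  then show ?thesis
    by (simp add: Zmod_times_Zr.ord_unique)
qed

lemma monomial_free_gen:
  assumes "J \<subseteq> {..<r}"
  shows "Zmod_times_Zr.monomial k r J (free_gen r) c = (0, \<lambda>i\<in>{..<r}. if i \<in> J then c i else 0)"
proof -
  have "finite J" using assms finite_subset by blast
  then show ?thesis
    using assms
  proof (induction J)
    case empty
    then show ?case by (simp add: Zmod_times_Zr.monomial_def one_Zmod_times_Zr restrict_def)
  next
    case (insert j J)
    then have "Zmod_times_Zr.monomial k r (insert j J) (free_gen r) c
        = free_gen r j [^]\<^bsub>Zmod_times_Zr k r\<^esub> c j
            \<otimes>\<^bsub>Zmod_times_Zr k r\<^esub> Zmod_times_Zr.monomial k r J (free_gen r) c"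
      unfolding Zmod_times_Zr.monomial_def by (intro Zmod_times_Zr.finprod_insert) auto
    also have "\<dots> = (0, \<lambda>i\<in>{..<r}. (if i = j then c j else 0) + (if i \<in> J then c i else 0))"
      using insert by (simp add: int_pow_free_gen mult_Zmod_times_Zr cong: restrict_cong)
    also have "\<dots> = (0, \<lambda>i\<in>{..<r}. if i \<in> insert j J then c i else 0)"
      using insert.hyps by (auto intro: restrict_ext)
    finally show ?case .
  qed
qed

lemma generate_Zmod_times_Zr:
  "generate (Zmod_times_Zr k r) (insert (torsion_gen k r) (free_gen r ` {..<r}))
     = carrier (Zmod_times_Zr k r)" (is "generate ?T ?X = _")
proof
  show "generate ?T ?X \<subseteq> carrier ?T"
    by (rule Zmod_times_Zr.generate_incl) auto
  show "carrier ?T \<subseteq> generate ?T ?X"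
  proof
    fix x assume x: "x \<in> carrier ?T"
    let ?t = "torsion_gen k r [^]\<^bsub>?T\<^esub> fst x"
    let ?f = "Zmod_times_Zr.monomial k r {..<r} (free_gen r) (snd x)"
    have "?t \<in> generate ?T ?X"
      by (intro Zmod_times_Zr.subgroup_int_pow_closed[OF Zmod_times_Zr.generate_is_subgroup]
          generate.incl) auto
    moreover have "?f \<in> generate ?T (free_gen r ` {..<r})"
      by (subst Zmod_times_Zr.generate_eq_monomials) auto
    then have "?f \<in> generate ?T ?X"
      using Zmod_times_Zr.mono_generate[of "free_gen r ` {..<r}" ?X] by blast
    ultimately have "?t \<otimes>\<^bsub>?T\<^esub> ?f \<in> generate ?T ?X"
      by (rule generate.eng)
    moreover have "?t \<otimes>\<^bsub>?T\<^esub> ?f = x"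
    proof (rule prod_eqI)
      show "fst (?t \<otimes>\<^bsub>?T\<^esub> ?f) = fst x"
        using x by (simp add: int_pow_torsion_gen monomial_free_gen mult_Zmod_times_Zr
            carrier_Zmod_times_Zr carrier_integer_mod_group mem_Times_iff split: if_splits)
      have "snd (?t \<otimes>\<^bsub>?T\<^esub> ?f) = restrict (snd x) {..<r}"
        by (simp add: int_pow_torsion_gen monomial_free_gen mult_Zmod_times_Zr cong: restrict_cong)
      then show "snd (?t \<otimes>\<^bsub>?T\<^esub> ?f) = snd x"
        using x PiE_restrict[of "snd x" "{..<r}" "\<lambda>_. UNIV"]
        by (simp add: carrier_Zmod_times_Zr mem_Times_iff)
    qed
    ultimately show "x \<in> generate ?T ?X" by simp
  qed
qed

definition (in comm_group) Zmod_times_Zr_lift ::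
  "nat \<Rightarrow> 'a \<Rightarrow> (nat \<Rightarrow> 'a) \<Rightarrow> int \<times> (nat \<Rightarrow> int) \<Rightarrow> 'a" where
  "Zmod_times_Zr_lift r d \<xi> x = d [^] fst x \<otimes> monomial {..<r} \<xi> (snd x)"

lemma (in comm_group)
  assumes d: "d \<in> carrier G" "d [^] k = \<one>" and \<xi>: "\<xi> \<in> {..<r} \<rightarrow> carrier G"
  shows Zmod_times_Zr_lift_hom: "Zmod_times_Zr_lift r d \<xi> \<in> hom (Zmod_times_Zr k r) G"
    and Zmod_times_Zr_lift_torsion_gen: "Zmod_times_Zr_lift r d \<xi> (torsion_gen k r) = d"
    and Zmod_times_Zr_lift_free_gen: "j < r \<Longrightarrow> Zmod_times_Zr_lift r d \<xi> (free_gen r j) = \<xi> j"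
proof -
  note [simp] = monomial_closed[OF \<xi>]
  show "Zmod_times_Zr_lift r d \<xi> \<in> hom (Zmod_times_Zr k r) G"
  proof (rule homI)
    fix x y
    have "monomial {..<r} \<xi> (snd (x \<otimes>\<^bsub>Zmod_times_Zr k r\<^esub> y)) = monomial {..<r} \<xi> (\<lambda>i. snd x i + snd y i)"
      by (rule monomial_cong[OF \<xi>]) (simp add: mult_Zmod_times_Zr)
    moreover have "d [^] fst (x \<otimes>\<^bsub>Zmod_times_Zr k r\<^esub> y) = d [^] fst x \<otimes> d [^] fst y"
      using d by (simp add: mult_Zmod_times_Zr int_pow_mod int_pow_mult)
    ultimately show "Zmod_times_Zr_lift r d \<xi> (x \<otimes>\<^bsub>Zmod_times_Zr k r\<^esub> y)
        = Zmod_times_Zr_lift r d \<xi> x \<otimes> Zmod_times_Zr_lift r d \<xi> y"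
      using d by (simp add: Zmod_times_Zr_lift_def m_ac flip: monomial_add[OF \<xi>])
  qed (simp add: Zmod_times_Zr_lift_def d)
  show "Zmod_times_Zr_lift r d \<xi> (torsion_gen k r) = d"
  proof -
    have "monomial {..<r} \<xi> (\<lambda>i\<in>{..<r}. 0) = \<one>"
      by (rule monomial_zero[OF \<xi>]) simp
    then show ?thesis
      using d by (simp add: Zmod_times_Zr_lift_def torsion_gen_def int_pow_mod)
  qed
  show "Zmod_times_Zr_lift r d \<xi> (free_gen r j) = \<xi> j" if "j < r"
    using that \<xi> monomial_single[OF \<xi>, of j "snd (free_gen r j)"]
    by (auto simp: Zmod_times_Zr_lift_def free_gen_def Pi_iff)
qed

definition elementary_abelian_group :: "nat \<Rightarrow> nat \<Rightarrow> (int \<times> (nat \<Rightarrow> int)) monoid" where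
  "elementary_abelian_group p r =
     integer_mod_group p \<times>\<times> product_group {..<r} (\<lambda>_. integer_mod_group p)"

definition reduce_mod :: "nat \<Rightarrow> nat \<Rightarrow> int \<times> (nat \<Rightarrow> int) \<Rightarrow> int \<times> (nat \<Rightarrow> int)" where
  "reduce_mod p r x = (fst x mod int p, \<lambda>i\<in>{..<r}. snd x i mod int p)"

lemma mult_elementary_abelian_group:
  "x \<otimes>\<^bsub>elementary_abelian_group p r\<^esub> y =
     ((fst x + fst y) mod int p, \<lambda>i\<in>{..<r}. (snd x i + snd y i) mod int p)"
  by (simp add: elementary_abelian_group_def mult_DirProd')

lemma one_elementary_abelian_group: "\<one>\<^bsub>elementary_abelian_group p r\<^esub> = (0, \<lambda>i\<in>{..<r}. 0)"
  by (simp add: elementary_abelian_group_def)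

lemma carrier_elementary_abelian_group:
  "p > 0 \<Longrightarrow> carrier (elementary_abelian_group p r) = {0..<int p} \<times> ({..<r} \<rightarrow>\<^sub>E {0..<int p})"
  by (simp add: elementary_abelian_group_def carrier_integer_mod_group)

lemma card_elementary_abelian_group:
  "p > 0 \<Longrightarrow> card (carrier (elementary_abelian_group p r)) = p ^ Suc r"
  by (simp add: carrier_elementary_abelian_group card_cartesian_product card_PiE)

lemma comm_group_elementary_abelian_group: "comm_group (elementary_abelian_group p r)"
proof (rule group.group_comm_groupI)
  show "group (elementary_abelian_group p r)"
    unfolding elementary_abelian_group_def by (intro DirProd_group product_group) auto
qed (simp add: mult_elementary_abelian_group ac_simps)

lemma pow_exponent_elementary_abelian_group:
  "x [^]\<^bsub>elementary_abelian_group p r\<^esub> p = \<one>\<^bsub>elementary_abelian_group p r\<^esub>"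
proof -
  have "x [^]\<^bsub>elementary_abelian_group p r\<^esub> m
      = (int m * fst x mod int p, \<lambda>i\<in>{..<r}. int m * snd x i mod int p)" for m
    by (induction m) (auto simp: one_elementary_abelian_group mult_elementary_abelian_group
        mod_simps algebra_simps intro!: restrict_ext)
  then show ?thesis by (simp add: one_elementary_abelian_group)
qed

lemma reduce_mod_hom:
  assumes "p > 0" "p dvd k"
  shows "reduce_mod p r \<in> hom (Zmod_times_Zr k r) (elementary_abelian_group p r)"
proof (rule homI)
  show "reduce_mod p r x \<in> carrier (elementary_abelian_group p r)" for x
    using assms(1) by (simp add: reduce_mod_def carrier_elementary_abelian_group)
  have "int p dvd int k" using assms(2) by simp
  then show "reduce_mod p r (x \<otimes>\<^bsub>Zmod_times_Zr k r\<^esub> y)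
      = reduce_mod p r x \<otimes>\<^bsub>elementary_abelian_group p r\<^esub> reduce_mod p r y" for x y
    by (simp add: reduce_mod_def mult_elementary_abelian_group mult_Zmod_times_Zr
        mod_simps mod_mod_cancel cong: restrict_cong)
qed

lemma reduce_mod_surj:
  assumes "p > 0" "k > 0" "p dvd k"
  shows "reduce_mod p r ` carrier (Zmod_times_Zr k r) = carrier (elementary_abelian_group p r)"
proof
  show "reduce_mod p r ` carrier (Zmod_times_Zr k r) \<subseteq> carrier (elementary_abelian_group p r)"
    using assms(1) by (auto simp: reduce_mod_def carrier_elementary_abelian_group)
  show "carrier (elementary_abelian_group p r) \<subseteq> reduce_mod p r ` carrier (Zmod_times_Zr k r)"
  proof
    fix x assume x: "x \<in> carrier (elementary_abelian_group p r)"
    have "int p \<le> int k" using assms by (simp add: dvd_imp_le)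
    then have "x \<in> carrier (Zmod_times_Zr k r)"
      using x assms(1,2) PiE_mono[of "{..<r}" "\<lambda>_. {0..<int p}" "\<lambda>_. UNIV"]
      by (auto simp: carrier_elementary_abelian_group carrier_Zmod_times_Zr carrier_integer_mod_group)
    moreover have "(\<lambda>i\<in>{..<r}. snd x i mod int p) = snd x"
    proof (rule PiE_ext)
      show "snd x \<in> {..<r} \<rightarrow>\<^sub>E {0..<int p}"
        using x assms(1) by (simp add: carrier_elementary_abelian_group mem_Times_iff)
      then show "(\<lambda>i\<in>{..<r}. snd x i mod int p) i = snd x i" if "i \<in> {..<r}" for i
        using that by (auto dest!: PiE_mem[of _ _ _ i])
    qed (use assms(1) in simp)
    then have "reduce_mod p r x = x"
      using x assms(1)
      by (simp add: reduce_mod_def carrier_elementary_abelian_group mem_Times_iff prod_eq_iff)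
    ultimately show "x \<in> reduce_mod p r ` carrier (Zmod_times_Zr k r)" by (metis image_eqI)
  qed
qed

lemma reduce_mod_torsion:
  assumes x: "x \<in> carrier (Zmod_times_Zr (N * p) r)"
    and torsion: "x [^]\<^bsub>Zmod_times_Zr (N * p) r\<^esub> N = \<one>\<^bsub>Zmod_times_Zr (N * p) r\<^esub>" and "N > 0"
  shows "reduce_mod p r x = \<one>\<^bsub>elementary_abelian_group p r\<^esub>"
proof -
  have pow: "(int N * fst x mod int (N * p), \<lambda>i\<in>{..<r}. int N * snd x i) = (0, \<lambda>i\<in>{..<r}. 0)"
    using torsion int_pow_Zmod_times_Zr[OF x, of "int N"] by (simp add: int_pow_int one_Zmod_times_Zr)
  then have "int N * int p dvd int N * fst x"
    by (simp add: mod_eq_0_iff_dvd)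
  then have "int p dvd fst x"
    using \<open>N > 0\<close> by simp
  moreover have "snd x i = 0" if "i < r" for i
    using pow \<open>N > 0\<close> that by (auto dest: fun_cong[of _ _ i])
  ultimately show ?thesis
    by (simp add: reduce_mod_def one_elementary_abelian_group cong: restrict_cong)
qed

theorem Zmod_times_Zr_torsion_generators_imp_eq_one:
  assumes \<phi>: "group_hom G (Zmod_times_Zr (N * p) r) \<phi>"
      "\<phi> ` carrier G = carrier (Zmod_times_Zr (N * p) r)"
    and gen: "\<xi> ` {..<r} \<union> Y \<subseteq> carrier G" "carrier G = generate G (\<xi> ` {..<r} \<union> Y)"
    and torsion: "\<And>y. y \<in> Y \<Longrightarrow> y [^]\<^bsub>G\<^esub> N = \<one>\<^bsub>G\<^esub>" and "N > 0" "p > 0"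
  shows "p = 1"
proof -
  let ?T = "Zmod_times_Zr (N * p) r" and ?E = "elementary_abelian_group p r"
  interpret E: comm_group ?E by (rule comm_group_elementary_abelian_group)
  interpret \<phi>: group_hom G ?T \<phi> by fact
  define \<rho> where "\<rho> = reduce_mod p r \<circ> \<phi>"
  interpret \<rho>: group_hom G ?E \<rho>
    using Group.hom_compose[OF \<phi>.homh reduce_mod_hom] \<open>p > 0\<close> unfolding \<rho>_def by unfold_locales simp
  let ?\<Xi> = "generate ?E ((\<rho> \<circ> \<xi>) ` {..<r})"
  have \<xi>: "\<rho> \<circ> \<xi> \<in> {..<r} \<rightarrow> carrier ?E"
    using gen(1) by auto
  have "\<rho> y = \<one>\<^bsub>?E\<^esub>" if "y \<in> Y" for y
    using reduce_mod_torsion[of "\<phi> y" N p r] \<phi>.hom_nat_pow[of y N] torsion[OF that] that gen(1) \<open>N > 0\<close>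
    by (auto simp: \<rho>_def)
  then have "\<rho> ` (\<xi> ` {..<r} \<union> Y) \<subseteq> ?\<Xi>"
    by (auto intro: generate.incl generate.one)
  then have "generate ?E (\<rho> ` (\<xi> ` {..<r} \<union> Y)) \<subseteq> ?\<Xi>"
    using \<xi> by (intro E.generate_subgroup_incl E.generate_is_subgroup) auto
  moreover have "generate ?E (\<rho> ` (\<xi> ` {..<r} \<union> Y)) = carrier ?E"
    using \<rho>.generate_img[OF gen(1)] gen(2) \<phi>(2) reduce_mod_surj[of p "N * p" r] \<open>N > 0\<close> \<open>p > 0\<close>
    unfolding \<rho>_def image_comp[symmetric] by simp
  ultimately have "?\<Xi> = carrier ?E"
    using \<xi> by (intro antisym E.generate_incl) auto
  moreover have "card ?\<Xi> \<le> p ^ card {..<r}"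
    by (rule E.card_generate_exponent_le[OF \<xi>])
      (simp_all add: \<open>p > 0\<close> pow_exponent_elementary_abelian_group)
  ultimately have "p ^ Suc r \<le> p ^ r"
    using card_elementary_abelian_group[OF \<open>p > 0\<close>, of r] by simp
  then show ?thesis
    using \<open>p > 0\<close> by simp
qed

section \<open>Coprime representatives\<close>

lemma exists_coprime_shift:
  fixes a b n :: "'a :: factorial_ring_gcd"
  assumes "n \<noteq> 0" "coprime a (gcd b n)"
  obtains k where "coprime (a + k * b) n"
proof -
  define S where "S = {p :: 'a. Factorial_Ring.prime p \<and> p dvd n \<and> \<not> p dvd a}"
  have fin: "finite S"
    by (rule finite_subset[OF _ finite_prime_divisors[OF assms(1)]]) (auto simp: S_def)
  have "\<not> p dvd a + \<Prod>S * b" if p: "Factorial_Ring.prime p" "p dvd n" for p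
  proof (cases "p dvd a")
    case True
    then have "\<not> p dvd b"
      using coprime_common_divisor[OF assms(2), of p] p by auto
    moreover have "\<not> p dvd \<Prod>S"
    proof
      assume "p dvd \<Prod>S"
      then obtain q where "q \<in> S" "p dvd q" using p(1) fin by (auto simp: prime_dvd_prod_iff)
      then show False using True p(1) primes_dvd_imp_eq[of p q] by (auto simp: S_def)
    qed
    ultimately show ?thesis
      using True p(1) by (simp add: dvd_add_right_iff prime_dvd_mult_iff)
  next
    case False
    then have "p \<in> S" using p by (simp add: S_def)
    then have "p dvd \<Prod>S" using dvd_prodI[OF fin, of p "\<lambda>x. x"] by simp
    then show ?thesis using False by (simp add: dvd_add_left_iff)
  qed
  moreover have "gcd (a + \<Prod>S * b) n \<noteq> 0"
    using \<open>n \<noteq> 0\<close> by simp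
  ultimately have "is_unit (gcd (a + \<Prod>S * b) n)"
    using prime_divisor_exists[of "gcd (a + \<Prod>S * b) n"] by auto
  then have "coprime (a + \<Prod>S * b) n"
    by (simp add: is_unit_gcd_iff coprime_iff_gcd_eq_1)
  then show ?thesis by (rule that)
qed

lemma gcd_mult_dvd_mult_gcd: "gcd (a * b) c dvd gcd a c * gcd b (c :: 'a :: semiring_gcd)"
proof -
  obtain d e where factors: "gcd (a * b) c = d * e" "d dvd a" "e dvd b"
    using division_decomp[of "gcd (a * b) c" a b] by auto
  have "d * e dvd c"
    by (simp flip: factors(1))
  then have "d dvd c" "e dvd c"
    by (rule dvd_mult_left, rule dvd_mult_right)
  with factors show ?thesis
    by (simp add: mult_dvd_mono)
qed

lemma exists_coprime_cong:
  fixes n m1 m2 s t :: int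
  assumes "n \<noteq> 0" "coprime m1 m2" "coprime s (gcd m1 n)" "coprime t (gcd m2 n)"
  obtains c where "coprime c n" "[c = s] (mod m1)" "[c = t] (mod m2)"
proof -
  obtain c where c: "[c = s] (mod m1)" "[c = t] (mod m2)"
    using binary_chinese_remainder_int[OF assms(2)] by blast
  have "coprime c (gcd m1 n)"
    by (rule cong_imp_coprime[OF cong_dvd_modulus[OF cong_sym[OF c(1)] gcd_dvd1] assms(3)])
  moreover have "coprime c (gcd m2 n)"
    by (rule cong_imp_coprime[OF cong_dvd_modulus[OF cong_sym[OF c(2)] gcd_dvd1] assms(4)])
  ultimately have "coprime c (gcd m1 n * gcd m2 n)"
    by simp
  then have "coprime c (gcd (m1 * m2) n)"
    by (rule coprime_divisors[OF dvd_refl gcd_mult_dvd_mult_gcd])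
  then obtain k where "coprime (c + k * (m1 * m2)) n"
    using exists_coprime_shift[OF assms(1)] by blast
  moreover have "[c + k * (m1 * m2) = s] (mod m1)"
    using c(1) by (simp add: cong_def mult.left_commute[of k])
  moreover have "[c + k * (m1 * m2) = t] (mod m2)"
    using c(2) by (simp add: cong_def flip: mult.assoc)
  ultimately show thesis by (rule that)
qed

lemma coprime_gcd_intI:
  fixes m n :: nat and s :: int
  assumes "\<And>p. p dvd m \<Longrightarrow> p dvd n \<Longrightarrow> int p dvd s \<Longrightarrow> p = 1"
  shows "coprime s (gcd (int m) (int n))"
proof -
  define p where "p = nat (gcd s (gcd (int m) (int n)))"
  have p: "int p = gcd s (gcd (int m) (int n))" by (simp add: p_def)
  have "int p dvd int m" "int p dvd int n" "int p dvd s"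
    unfolding p by (auto intro: dvd_trans[OF gcd_dvd2])
  then have "p = 1"
    by (intro assms) (simp_all only: int_dvd_int_iff)
  with p show ?thesis
    by (metis coprime_iff_gcd_eq_1 of_nat_1)
qed

section \<open>Central extensions by a cyclic group\<close>

lemma carrier_integer_mod_group_eq_range: "carrier (integer_mod_group n) = range (\<lambda>k. k mod int n)"
proof
  show "carrier (integer_mod_group n) \<subseteq> range (\<lambda>k. k mod int n)"
  proof
    fix k assume "k \<in> carrier (integer_mod_group n)"
    then have "k = k mod int n"
      by (simp add: carrier_integer_mod_group split: if_splits)
    then show "k \<in> range (\<lambda>k. k mod int n)" by (rule range_eqI)
  qed
qed (auto simp: carrier_integer_mod_group)

locale cyclic_central_extension = G: group G + Q: group Q
  for G :: "('a, 'c) monoid_scheme" (structure) and Q :: "('b, 'd) monoid_scheme" +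
  fixes \<pi> :: "'a \<Rightarrow> 'b" and n :: nat and z :: 'a
  assumes hom_\<pi>: "\<pi> \<in> hom G Q" and surj: "\<pi> ` carrier G = carrier Q"
    and z_closed [simp]: "z \<in> carrier G" and ord_z: "G.ord z = n"
    and z_central: "\<And>g. g \<in> carrier G \<Longrightarrow> z \<otimes> g = g \<otimes> z"
    and kernel_eq: "kernel G Q \<pi> = range (\<lambda>k::int. z [^] k)"
begin

sublocale \<pi>: group_hom G Q \<pi>
  by unfold_locales (rule hom_\<pi>)

lemma z_int_pow_eq_iff: "z [^] (j::int) = z [^] k \<longleftrightarrow> int n dvd k - j"
  by (simp add: G.int_pow_eq ord_z)

lemma z_int_pow_eq_one_iff: "z [^] (k::int) = \<one> \<longleftrightarrow> int n dvd k"
  by (simp add: G.int_pow_eq_id ord_z)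

lemma z_int_pow_central: "g \<in> carrier G \<Longrightarrow> z [^] (k::int) \<otimes> g = g \<otimes> z [^] k"
  by (simp add: G.int_pow_commutes z_central)

lemma \<pi>_z_int_pow [simp]: "\<pi> (z [^] (k::int)) = \<one>\<^bsub>Q\<^esub>"
proof -
  have "z [^] k \<in> kernel G Q \<pi>" unfolding kernel_eq by simp
  then show ?thesis by (simp add: kernel_def)
qed

lemma kernelE:
  assumes "g \<in> carrier G" "\<pi> g = \<one>\<^bsub>Q\<^esub>"
  obtains k :: int where "g = z [^] k"
  using assms kernel_eq by (auto simp: kernel_def)

lemma fibreE:
  assumes g: "g \<in> carrier G" and h: "h \<in> carrier G" and "\<pi> g = \<pi> h"
  obtains k :: int where "g = z [^] k \<otimes> h"
proof -
  have "\<pi> (g \<otimes> inv h) = \<one>\<^bsub>Q\<^esub>"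
    using assms by simp
  then obtain k :: int where "g \<otimes> inv h = z [^] k"
    using kernelE[of "g \<otimes> inv h"] g h by auto
  then have "g = z [^] k \<otimes> h"
    using g h by (metis G.inv_solve_right G.int_pow_closed z_closed)
  then show thesis by (rule that)
qed

lemma carrier_eq_generate:
  assumes A: "A \<subseteq> carrier G" "carrier Q = generate Q (\<pi> ` A)"
  shows "carrier G = generate G (insert z A)"
proof
  have sub: "subgroup (generate G (insert z A)) G"
    using A(1) by (intro G.generate_is_subgroup) simp
  show "carrier G \<subseteq> generate G (insert z A)"
  proof
    fix g assume g: "g \<in> carrier G"
    then have "\<pi> g \<in> \<pi> ` generate G A"
      using \<pi>.hom_closed[of g] A(2) \<pi>.generate_img[OF A(1)] by simp
    then obtain h where h: "h \<in> generate G A" "\<pi> g = \<pi> h" by blast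
    then obtain k :: int where k: "g = z [^] k \<otimes> h"
      using fibreE[OF g G.generate_in_carrier[OF A(1)]] by blast
    have "z [^] k \<in> generate G (insert z A)"
      by (intro G.subgroup_int_pow_closed[OF sub] generate.incl) simp
    moreover have "h \<in> generate G (insert z A)"
      using h(1) G.mono_generate[of A "insert z A"] by blast
    ultimately show "g \<in> generate G (insert z A)"
      unfolding k by (rule generate.eng)
  qed
  show "generate G (insert z A) \<subseteq> carrier G"
    using A(1) by (intro G.generate_incl) simp
qed

lemma lift_pow_eq_one:
  assumes y: "y \<in> carrier G" "y [^] m = z [^] (s::int)" and p: "p dvd m" "p dvd n" "int p dvd s"
  shows "y [^] (n * (m div p)) = \<one>"
proof -
  have "n * (m div p) = m * (n div p)"
    using p(1,2) by (metis div_mult_swap mult.commute)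
  then have "y [^] (n * (m div p)) = (z [^] s) [^] (n div p)"
    using y by (simp flip: G.nat_pow_pow)
  also have "\<dots> = z [^] (s * int (n div p))"
    by (simp add: G.int_pow_pow flip: int_pow_int)
  also have "\<dots> = \<one>"
  proof -
    have "int n = int p * int (n div p)"
      using p(2) by (simp flip: of_nat_mult)
    then show ?thesis
      using p(3) by (simp only: z_int_pow_eq_one_iff mult_dvd_mono dvd_refl)
  qed
  finally show ?thesis .
qed

lemma lift_mult_pow:
  assumes y: "y \<in> carrier G" "y [^] m = z [^] (s::int)"
  shows "(y \<otimes> z [^] i) [^] m = z [^] (s + int m * i)"
proof -
  have "(y \<otimes> z [^] i) [^] m = y [^] m \<otimes> (z [^] i) [^] m"
    using y(1) by (intro G.pow_mult_distrib) (simp_all add: z_int_pow_central)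
  then show ?thesis
    using y by (simp add: G.int_pow_mult G.int_pow_pow mult.commute flip: int_pow_int)
qed

lemma central_extension: "central_extension (integer_mod_group n) G Q"
proof -
  let ?\<iota> = "\<lambda>k::int. z [^] k" and ?N = "integer_mod_group n"
  have z_n: "z [^] n = \<one>"
    using G.pow_ord_eq_1[OF z_closed] by (simp add: ord_z)
  have "?\<iota> \<in> hom ?N G"
    by (rule homI) (simp_all add: G.int_pow_mod[OF z_closed z_n] G.int_pow_mult)
  moreover have "inj_on ?\<iota> (carrier ?N)"
  proof (rule inj_onI)
    fix j k assume "j \<in> carrier ?N" "k \<in> carrier ?N" "z [^] j = z [^] k"
    then show "j = k"
      by (auto simp: z_int_pow_eq_iff carrier_integer_mod_group mod_eq_dvd_iff[symmetric]
          split: if_splits)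
  qed
  moreover have "kernel G Q \<pi> = ?\<iota> ` carrier ?N"
    by (simp add: kernel_eq carrier_integer_mod_group_eq_range image_image
        G.int_pow_mod[OF z_closed z_n])
  ultimately show ?thesis
    unfolding central_extension_def using hom_\<pi> surj z_int_pow_central
    by (intro exI[of _ ?\<iota>] exI[of _ \<pi>]) auto
qed

end

lemma central_extension_integer_mod_group_cyclic:
  assumes "group G" "group Q" "central_extension (integer_mod_group n) G Q"
  obtains \<pi> z where "cyclic_central_extension G Q \<pi> n z"
proof -
  interpret G: group G by fact
  interpret Q: group Q by fact
  let ?N = "integer_mod_group n"
  interpret N: group ?N by simp
  obtain \<iota> \<pi> where \<iota>: "\<iota> \<in> hom ?N G" "inj_on \<iota> (carrier ?N)"
    and \<pi>: "\<pi> \<in> hom G Q" "\<pi> ` carrier G = carrier Q" and ker: "kernel G Q \<pi> = \<iota> ` carrier ?N"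
    and central: "\<And>z g. z \<in> \<iota> ` carrier ?N \<Longrightarrow> g \<in> carrier G \<Longrightarrow> z \<otimes>\<^bsub>G\<^esub> g = g \<otimes>\<^bsub>G\<^esub> z"
    using assms(3) unfolding central_extension_def by metis
  interpret \<iota>: group_hom ?N G \<iota> by unfold_locales (rule \<iota>(1))
  have one: "1 mod int n \<in> carrier ?N"
    by (simp add: carrier_integer_mod_group_eq_range)
  have \<iota>_mod: "\<iota> (1 mod int n) [^]\<^bsub>G\<^esub> k = \<iota> (k mod int n)" for k :: int
    using \<iota>.hom_int_pow[OF one, of k] by (simp add: int_pow_integer_mod_group mod_simps)
  have "\<iota> (1 mod int n) [^]\<^bsub>G\<^esub> k = \<one>\<^bsub>G\<^esub> \<longleftrightarrow> n dvd k" for k :: nat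
  proof -
    have "\<iota> (1 mod int n) [^]\<^bsub>G\<^esub> k = \<one>\<^bsub>G\<^esub> \<longleftrightarrow> \<iota> (int k mod int n) = \<iota> 0"
      using \<iota>_mod[of "int k"] \<iota>.hom_one by (simp add: int_pow_int)
    also have "\<dots> \<longleftrightarrow> int k mod int n = 0"
      using \<iota>(2) by (intro inj_on_eq_iff) (auto simp: carrier_integer_mod_group)
    finally show ?thesis by (simp add: mod_eq_0_iff_dvd)
  qed
  then have "G.ord (\<iota> (1 mod int n)) = n"
    using one by (simp add: G.ord_unique)
  moreover have "\<iota> ` carrier ?N = range (\<lambda>k::int. \<iota> (1 mod int n) [^]\<^bsub>G\<^esub> k)"
    by (simp add: \<iota>_mod carrier_integer_mod_group_eq_range image_image)
  moreover have "\<iota> (1 mod int n) \<otimes>\<^bsub>G\<^esub> g = g \<otimes>\<^bsub>G\<^esub> \<iota> (1 mod int n)" if "g \<in> carrier G" for g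
    using central[OF imageI[OF one] that] .
  ultimately have "cyclic_central_extension G Q \<pi> n (\<iota> (1 mod int n))"
    using \<pi> ker one by unfold_locales auto
  then show thesis by (rule that)
qed

locale cyclic_central_extension_hom =
  G: cyclic_central_extension G Q \<pi> n z + G': cyclic_central_extension G' Q \<pi>' n z'
  for G :: "('a, 'c) monoid_scheme" (structure) and Q :: "('b, 'd) monoid_scheme" and \<pi> n z
    and G' :: "('e, 'f) monoid_scheme" and \<pi>' z' +
  fixes F :: "'a \<Rightarrow> 'e" and c :: int
  assumes hom_F: "F \<in> hom G G'" and \<pi>'_F: "\<And>g. g \<in> carrier G \<Longrightarrow> \<pi>' (F g) = \<pi> g"
    and F_z: "F z = z' [^]\<^bsub>G'\<^esub> c" and coprime_c: "coprime c (int n)"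
begin

sublocale F: group_hom G G' F
  by unfold_locales (rule hom_F)

lemma F_z_int_pow: "F (z [^] (k::int)) = z' [^]\<^bsub>G'\<^esub> (c * k)"
  by (simp add: F.hom_int_pow F_z G'.G.int_pow_pow)

lemma kernel_F: "kernel G G' F = {\<one>}"
proof -
  have "h = \<one>" if h: "h \<in> carrier G" "F h = \<one>\<^bsub>G'\<^esub>" for h
  proof -
    have "\<pi> h = \<one>\<^bsub>Q\<^esub>"
      using \<pi>'_F[OF h(1)] h(2) by simp
    then obtain k :: int where k: "h = z [^] k"
      using G.kernelE[OF h(1)] by blast
    then have "int n dvd c * k"
      using h(2) F_z_int_pow by (simp add: G'.z_int_pow_eq_one_iff)
    then show ?thesis
      using coprime_c
      by (simp add: k G.z_int_pow_eq_one_iff coprime_commute coprime_dvd_mult_right_iff)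
  qed
  then show ?thesis by (auto simp: kernel_def)
qed

lemma F_surj: "F ` carrier G = carrier G'"
proof
  show "carrier G' \<subseteq> F ` carrier G"
  proof
    fix g assume g: "g \<in> carrier G'"
    obtain h where h: "h \<in> carrier G" "\<pi>' g = \<pi>' (F h)"
      using G.surj G'.\<pi>.hom_closed[OF g] \<pi>'_F by (metis imageE)
    then obtain j :: int where j: "g = z' [^]\<^bsub>G'\<^esub> j \<otimes>\<^bsub>G'\<^esub> F h"
      using G'.fibreE[OF g F.hom_closed] by blast
    obtain x where "[c * x = 1] (mod int n)"
      using cong_solve_coprime_int[OF coprime_c] by blast
    then have "[j = c * (x * j)] (mod int n)"
      using cong_scalar_right[of 1 "c * x" "int n" j] by (simp add: mult.assoc cong_sym)
    then have "F (z [^] (x * j)) = z' [^]\<^bsub>G'\<^esub> j"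
      by (simp add: F_z_int_pow G'.z_int_pow_eq_iff cong_iff_dvd_diff)
    then have "g = F (z [^] (x * j) \<otimes> h)"
      using h(1) j by simp
    then show "g \<in> F ` carrier G"
      by (rule image_eqI) (simp add: h(1))
  qed
qed auto

theorem iso: "F \<in> iso G G'"
  using hom_F kernel_F F_surj iso_kernel_image[OF G.G.group_axioms G'.G.group_axioms] by blast

end

lemma cyclic_central_extension_DirProd:
  assumes "group Q"
  shows "cyclic_central_extension (integer_mod_group n \<times>\<times> Q) Q snd n (1 mod int n, \<one>\<^bsub>Q\<^esub>)"
proof -
  let ?N = "integer_mod_group n" and ?G = "integer_mod_group n \<times>\<times> Q"
  interpret Q: group Q by fact
  interpret G: group ?G by (rule DirProd_group) (simp_all add: Q.group_axioms)
  have one: "1 mod int n \<in> carrier ?N"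
    by (simp add: carrier_integer_mod_group_eq_range)
  have "(\<lambda>k. (k, \<one>\<^bsub>Q\<^esub>)) \<in> hom ?N ?G"
    by (rule homI) simp_all
  then have pow: "(1 mod int n, \<one>\<^bsub>Q\<^esub>) [^]\<^bsub>?G\<^esub> k = (k mod int n, \<one>\<^bsub>Q\<^esub>)" for k :: int
    using hom_int_pow[of "\<lambda>k. (k, \<one>\<^bsub>Q\<^esub>)" ?N ?G "1 mod int n" k] one G.group_axioms
    by (simp add: int_pow_integer_mod_group mod_simps)
  show ?thesis
  proof unfold_locales
    show "snd \<in> hom ?G Q"
      by (rule homI) (simp_all add: mult_DirProd' mem_Times_iff)
    show "snd ` carrier ?G = carrier Q"
      using one by force
    show "G.ord (1 mod int n, \<one>\<^bsub>Q\<^esub>) = n"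
      using one pow[of "int _"] by (simp add: G.ord_unique int_pow_int mod_eq_0_iff_dvd)
    show "kernel ?G Q snd = range (\<lambda>k::int. (1 mod int n, \<one>\<^bsub>Q\<^esub>) [^]\<^bsub>?G\<^esub> k)"
      by (auto simp: pow kernel_def carrier_integer_mod_group_eq_range)
  qed (use one in \<open>auto simp: mult_DirProd' add.commute\<close>)
qed

section \<open>The groups \<open>H\<close> and \<open>Q\<close> by generators and relations\<close>

definition H_relators :: "nat \<Rightarrow> nat \<Rightarrow> nat \<Rightarrow> nat \<Rightarrow> (hgen \<times> bool) list set" where
  "H_relators n m1 m2 r =
     {wpow (wgen GA) m1 @ winv (wpow (wgen GB) m2),
       wpow (wgen GA) (m1 * n)}
      \<union> {wpow (wgen GA) m1 @ wgen (GX i) @ winv (wpow (wgen GA) m1) @ winv (wgen (GX i)) | i. i < r}"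

definition Q_relators :: "nat \<Rightarrow> nat \<Rightarrow> (hgen \<times> bool) list set" where
  "Q_relators m1 m2 = {wpow (wgen GA) m1, wpow (wgen GB) m2}"

lemma hgens_cases:
  assumes "s \<in> hgens r"
  obtains (GA) "s = GA" | (GB) "s = GB" | (GX) i where "i < r" "s = GX i"
  using assms by (auto simp: hgens_def)

lemma GA_in_hgens [simp]: "GA \<in> hgens r" and GB_in_hgens [simp]: "GB \<in> hgens r"
  and GX_in_hgens [simp]: "GX i \<in> hgens r \<longleftrightarrow> i < r"
  by (auto simp: hgens_def)

lemma set_wgen: "s \<in> S \<Longrightarrow> set (wgen s) \<subseteq> S \<times> UNIV"
  by (simp add: wgen_def)

lemma set_wpow: "set w \<subseteq> S \<times> UNIV \<Longrightarrow> set (wpow w k) \<subseteq> S \<times> UNIV"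
  by (auto simp: wpow_def)

lemmas set_word_subset = set_wgen set_wpow set_winv

definition H_relations ::
  "('g, 'c) monoid_scheme \<Rightarrow> nat \<Rightarrow> nat \<Rightarrow> nat \<Rightarrow> nat \<Rightarrow> (hgen \<Rightarrow> 'g) \<Rightarrow> bool" where
  "H_relations G n m1 m2 r f \<longleftrightarrow>
     f GA [^]\<^bsub>G\<^esub> m1 = f GB [^]\<^bsub>G\<^esub> m2 \<and> f GA [^]\<^bsub>G\<^esub> (m1 * n) = \<one>\<^bsub>G\<^esub> \<and>
     (\<forall>i<r. f GA [^]\<^bsub>G\<^esub> m1 \<otimes>\<^bsub>G\<^esub> f (GX i) = f (GX i) \<otimes>\<^bsub>G\<^esub> f GA [^]\<^bsub>G\<^esub> m1)"

context group begin

lemma commutator_eq_one_iff: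
  assumes "x \<in> carrier G" "y \<in> carrier G"
  shows "x \<otimes> (y \<otimes> (inv x \<otimes> inv y)) = \<one> \<longleftrightarrow> x \<otimes> y = y \<otimes> x"
proof -
  have "x \<otimes> (y \<otimes> (inv x \<otimes> inv y)) = (x \<otimes> y) \<otimes> inv (y \<otimes> x)"
    using assms by (simp add: m_assoc inv_mult_group)
  then show ?thesis
    using assms by (simp add: eq_iff_mult_inv_eq_one)
qed

lemma weval_H_relators:
  assumes f: "f ` hgens r \<subseteq> carrier G"
  shows "(\<forall>w\<in>H_relators n m1 m2 r. weval G f w = \<one>) \<longleftrightarrow> H_relations G n m1 m2 r f"
proof -
  have closed: "f GA \<in> carrier G" "f GB \<in> carrier G" "\<And>i. i < r \<Longrightarrow> f (GX i) \<in> carrier G"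
    using f by auto
  note weval_word = weval_append[OF f] weval_winv[OF f] weval_wpow[OF f] weval_wgen set_word_subset
  have "weval G f (wpow (wgen GA) m1 @ winv (wpow (wgen GB) m2)) = f GA [^] m1 \<otimes> inv (f GB [^] m2)"
    using closed by (simp add: weval_word)
  moreover have "weval G f (wpow (wgen GA) (m1 * n)) = f GA [^] (m1 * n)"
    using closed by (simp add: weval_word)
  moreover have "weval G f
        (wpow (wgen GA) m1 @ wgen (GX i) @ winv (wpow (wgen GA) m1) @ winv (wgen (GX i)))
      = f GA [^] m1 \<otimes> (f (GX i) \<otimes> (inv (f GA [^] m1) \<otimes> inv f (GX i)))" if "i < r" for i
    using closed that by (simp add: weval_word)
  ultimately show ?thesis
    using closed
    by (auto simp: H_relators_def H_relations_def commutator_eq_one_iff eq_iff_mult_inv_eq_one)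
qed

lemma weval_Q_relators:
  assumes f: "f ` hgens r \<subseteq> carrier G"
  shows "(\<forall>w\<in>Q_relators m1 m2. weval G f w = \<one>) \<longleftrightarrow> f GA [^] m1 = \<one> \<and> f GB [^] m2 = \<one>"
proof -
  have "f GA \<in> carrier G" "f GB \<in> carrier G"
    using f by auto
  then show ?thesis
    by (simp add: Q_relators_def weval_wpow[OF f] weval_wgen set_word_subset)
qed

end

lemma (in group_hom) H_relations_hom:
  assumes f: "f ` hgens r \<subseteq> carrier G" and rel: "H_relations G n m1 m2 r f"
  shows "H_relations H n m1 m2 r (\<lambda>s. h (f s))"
proof -
  have "f GA \<in> carrier G" "f GB \<in> carrier G" "\<And>i. i < r \<Longrightarrow> f (GX i) \<in> carrier G"
    using f by auto
  then show ?thesis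
    using rel unfolding H_relations_def by (metis hom_mult hom_nat_pow hom_one G.nat_pow_closed)
qed

locale extension_parameters =
  fixes n m1 m2 r :: nat
begin

abbreviation H :: "(hgen \<times> bool) list set monoid" where
  "H \<equiv> H_group n m1 m2 r"

abbreviation Q :: "(hgen \<times> bool) list set monoid" where
  "Q \<equiv> Q_group m1 m2 r"

sublocale H: presentation H "hgens r" "H_relators n m1 m2 r"
  by unfold_locales (auto simp: H_group_def H_relators_def wpow_def wgen_def winv_def)

sublocale Q: presentation Q "hgens r" "Q_relators m1 m2"
  by unfold_locales (auto simp: Q_group_def Q_relators_def wpow_def wgen_def winv_def)

abbreviation \<alpha> :: "(hgen \<times> bool) list set" where
  "\<alpha> \<equiv> H.gen GA"

abbreviation \<beta> :: "(hgen \<times> bool) list set" where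
  "\<beta> \<equiv> H.gen GB"

abbreviation z :: "(hgen \<times> bool) list set" where
  "z \<equiv> \<alpha> [^]\<^bsub>H\<^esub> m1"

lemma H_relations_gen: "H_relations H n m1 m2 r H.gen"
  using H.weval_H_relators[OF H.gen_image_closed] H.weval_relator by blast

lemma Q_relations_gen:
  "Q.gen GA [^]\<^bsub>Q\<^esub> m1 = \<one>\<^bsub>Q\<^esub>" "Q.gen GB [^]\<^bsub>Q\<^esub> m2 = \<one>\<^bsub>Q\<^esub>"
  using Q.weval_Q_relators[OF Q.gen_image_closed] Q.weval_relator by blast+

lemma H_universal:
  assumes "group K" "f ` hgens r \<subseteq> carrier K" "H_relations K n m1 m2 r f"
  obtains h where "group_hom H K h" "\<And>s. s \<in> hgens r \<Longrightarrow> h (H.gen s) = f s"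
  using H.von_Dyck[OF assms(1,2)] group.weval_H_relators[OF assms(1,2)] assms(3) by blast

lemma Q_universal:
  assumes "group K" "f ` hgens r \<subseteq> carrier K" "f GA [^]\<^bsub>K\<^esub> m1 = \<one>\<^bsub>K\<^esub>" "f GB [^]\<^bsub>K\<^esub> m2 = \<one>\<^bsub>K\<^esub>"
  obtains h where "group_hom Q K h" "\<And>s. s \<in> hgens r \<Longrightarrow> h (Q.gen s) = f s"
  using Q.von_Dyck[OF assms(1,2)] group.weval_Q_relators[OF assms(1,2)] assms(3,4) by blast

lemma \<beta>_pow_m2: "\<beta> [^]\<^bsub>H\<^esub> m2 = z"
  using H_relations_gen unfolding H_relations_def by simp

lemma z_pow_n: "z [^]\<^bsub>H\<^esub> n = \<one>\<^bsub>H\<^esub>"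
proof -
  have "\<alpha> [^]\<^bsub>H\<^esub> (m1 * n) = \<one>\<^bsub>H\<^esub>"
    using H_relations_gen unfolding H_relations_def by blast
  then show ?thesis by (simp add: H.nat_pow_pow)
qed

lemma z_central:
  assumes "x \<in> carrier H"
  shows "z \<otimes>\<^bsub>H\<^esub> x = x \<otimes>\<^bsub>H\<^esub> z"
proof -
  have gen: "z \<otimes>\<^bsub>H\<^esub> H.gen s = H.gen s \<otimes>\<^bsub>H\<^esub> z" if "s \<in> hgens r" for s
    using that
  proof (cases rule: hgens_cases)
    case GA
    then show ?thesis by (simp add: H.group_commutes_pow)
  next
    case GB
    then show ?thesis by (simp add: H.group_commutes_pow flip: \<beta>_pow_m2)
  next
    case GX
    then show ?thesis using H_relations_gen unfolding H_relations_def by blast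
  qed
  show ?thesis
  proof (rule H.commutes_with_generate[OF _ H.gen_image_closed])
    show "z \<otimes>\<^bsub>H\<^esub> a = a \<otimes>\<^bsub>H\<^esub> z" if "a \<in> H.gen ` hgens r" for a
      using that by (elim imageE) (simp only: gen)
    show "x \<in> generate H (H.gen ` hgens r)"
      using assms by (simp only: H.carrier_eq_generate)
  qed simp
qed

end

section \<open>The abelianization of \<open>H\<close>\<close>

locale coprime_parameters = extension_parameters +
  assumes n_pos: "n > 0" and m1_pos: "m1 > 0" and m2_pos: "m2 > 0" and coprime_m: "coprime m1 m2"
begin

abbreviation M :: nat where
  "M \<equiv> n * m1 * m2"

abbreviation T :: "(int \<times> (nat \<Rightarrow> int)) monoid" where
  "T \<equiv> Zmod_times_Zr M r"

lemma bezout_m: obtains u v :: int where "u * int m2 + v * int m1 = 1"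
  using bezout_int[of "int m2" "int m1"] coprime_m
  by (auto simp: coprime_commute coprime_iff_gcd_eq_1)

definition ab_gen :: "hgen \<Rightarrow> int \<times> (nat \<Rightarrow> int)" where
  "ab_gen s = (case s of
       GA \<Rightarrow> torsion_gen M r [^]\<^bsub>T\<^esub> m2
     | GB \<Rightarrow> torsion_gen M r [^]\<^bsub>T\<^esub> m1
     | GX j \<Rightarrow> free_gen r j)"

lemma ab_gen_closed [simp]: "ab_gen s \<in> carrier T"
  by (simp add: ab_gen_def split: hgen.split)

lemma torsion_gen_pow_M: "torsion_gen M r [^]\<^bsub>T\<^esub> M = \<one>\<^bsub>T\<^esub>"
  using Zmod_times_Zr.pow_ord_eq_1[OF torsion_gen_closed] by (simp only: ord_torsion_gen)

lemma H_relations_ab_gen: "H_relations T n m1 m2 r ab_gen"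
proof -
  have "ab_gen GA [^]\<^bsub>T\<^esub> m1 = ab_gen GB [^]\<^bsub>T\<^esub> m2"
    by (simp add: ab_gen_def Zmod_times_Zr.nat_pow_pow mult.commute)
  moreover have "ab_gen GA [^]\<^bsub>T\<^esub> (m1 * n) = \<one>\<^bsub>T\<^esub>"
    using torsion_gen_pow_M by (simp add: ab_gen_def Zmod_times_Zr.nat_pow_pow ac_simps)
  ultimately show ?thesis
    by (simp add: H_relations_def Zmod_times_Zr.m_comm)
qed

lemma carrier_T_eq_generate: "carrier T = generate T (ab_gen ` hgens r)"
proof
  let ?I = "generate T (ab_gen ` hgens r)"
  have sub: "subgroup ?I T" by (rule Zmod_times_Zr.generate_is_subgroup) auto
  have gen: "ab_gen s \<in> ?I" if "s \<in> hgens r" for s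
    using that by (intro generate.incl) simp
  obtain u v where bezout: "u * int m2 + v * int m1 = 1" by (rule bezout_m)
  have "torsion_gen M r = torsion_gen M r [^]\<^bsub>T\<^esub> (int m2 * u + int m1 * v)"
    using bezout by (simp add: mult.commute)
  also have "\<dots> = ab_gen GA [^]\<^bsub>T\<^esub> u \<otimes>\<^bsub>T\<^esub> ab_gen GB [^]\<^bsub>T\<^esub> v"
    by (simp add: ab_gen_def Zmod_times_Zr.int_pow_mult Zmod_times_Zr.int_pow_pow flip: int_pow_int)
  also have "\<dots> \<in> ?I"
    by (intro subgroup.m_closed[OF sub] Zmod_times_Zr.subgroup_int_pow_closed[OF sub] gen) auto
  finally have "torsion_gen M r \<in> ?I" .
  moreover have "free_gen r j \<in> ?I" if "j < r" for j
    using gen[of "GX j"] that by (simp add: ab_gen_def)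
  ultimately have "generate T (insert (torsion_gen M r) (free_gen r ` {..<r})) \<subseteq> ?I"
    by (intro Zmod_times_Zr.generate_subgroup_incl[OF _ sub]) auto
  then show "carrier T \<subseteq> ?I"
    by (simp add: generate_Zmod_times_Zr)
qed (rule Zmod_times_Zr.generate_incl, auto)

lemma H_to_T:
  obtains \<phi> where "group_hom H T \<phi>" "\<And>s. s \<in> hgens r \<Longrightarrow> \<phi> (H.gen s) = ab_gen s"
    "\<phi> ` carrier H = carrier T"
proof -
  have "ab_gen ` hgens r \<subseteq> carrier T" by auto
  then obtain \<phi> where \<phi>: "group_hom H T \<phi>" "\<And>s. s \<in> hgens r \<Longrightarrow> \<phi> (H.gen s) = ab_gen s"
    using H_universal[OF Zmod_times_Zr.group_axioms _ H_relations_ab_gen] by blast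
  have "\<phi> ` H.gen ` hgens r = ab_gen ` hgens r"
    using \<phi>(2) by (simp add: image_image)
  then have "\<phi> ` carrier H = carrier T"
    using group_hom.generate_img[OF \<phi>(1) H.gen_image_closed]
      H.carrier_eq_generate carrier_T_eq_generate by simp
  with \<phi> show thesis by (rule that)
qed

lemma ord_z: "H.ord z = n"
proof -
  have "n dvd k" if "z [^]\<^bsub>H\<^esub> k = \<one>\<^bsub>H\<^esub>" for k :: nat
  proof -
    obtain \<phi> where \<phi>: "group_hom H T \<phi>" "\<And>s. s \<in> hgens r \<Longrightarrow> \<phi> (H.gen s) = ab_gen s"
      by (rule H_to_T) blast
    interpret \<phi>: group_hom H T \<phi> by (rule \<phi>(1))
    have "torsion_gen M r [^]\<^bsub>T\<^esub> (m2 * m1 * k) = \<phi> (z [^]\<^bsub>H\<^esub> k)"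
      by (simp add: \<phi>.hom_nat_pow \<phi>(2) ab_gen_def Zmod_times_Zr.nat_pow_pow)
    then have "M dvd m2 * m1 * k"
      using that by (simp add: Zmod_times_Zr.pow_eq_id ord_torsion_gen)
    then show "n dvd k"
      using m1_pos m2_pos by (simp add: mult.commute[of _ k] mult.assoc)
  qed
  moreover have "z [^]\<^bsub>H\<^esub> k = \<one>\<^bsub>H\<^esub>" if "n dvd k" for k :: nat
    using that z_pow_n by (elim dvdE) (simp flip: H.nat_pow_pow)
  ultimately show ?thesis
    by (auto simp: H.ord_unique)
qed

lemma T_universal:
  assumes "comm_group A" and f: "f ` hgens r \<subseteq> carrier A" and rel: "H_relations A n m1 m2 r f"
  obtains \<psi> where "\<psi> \<in> hom T A" "\<And>s. s \<in> hgens r \<Longrightarrow> \<psi> (ab_gen s) = f s"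
proof -
  interpret A: comm_group A by fact
  have closed: "f GA \<in> carrier A" "f GB \<in> carrier A" and x: "(\<lambda>j. f (GX j)) \<in> {..<r} \<rightarrow> carrier A"
    using f by auto
  have pow: "f GA [^]\<^bsub>A\<^esub> int m1 = f GB [^]\<^bsub>A\<^esub> int m2" and killed: "f GA [^]\<^bsub>A\<^esub> (m1 * n) = \<one>\<^bsub>A\<^esub>"
    using rel unfolding H_relations_def int_pow_int by blast+
  obtain u v where bezout: "u * int m2 + v * int m1 = 1" by (rule bezout_m)
  define d where "d = f GA [^]\<^bsub>A\<^esub> u \<otimes>\<^bsub>A\<^esub> f GB [^]\<^bsub>A\<^esub> v"
  have d: "d \<in> carrier A" using closed by (simp add: d_def)
  have d_a: "d [^]\<^bsub>A\<^esub> m2 = f GA" and d_b: "d [^]\<^bsub>A\<^esub> m1 = f GB"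
    using A.bezout_common_root[OF closed pow bezout] by (simp_all add: d_def int_pow_int)
  have "d [^]\<^bsub>A\<^esub> M = (d [^]\<^bsub>A\<^esub> m2) [^]\<^bsub>A\<^esub> (m1 * n)"
    using d by (simp add: A.nat_pow_pow ac_simps)
  then have d_M: "d [^]\<^bsub>A\<^esub> M = \<one>\<^bsub>A\<^esub>"
    by (simp only: d_a killed)
  define \<psi> where "\<psi> = A.Zmod_times_Zr_lift r d (\<lambda>j. f (GX j))"
  have \<psi>: "\<psi> \<in> hom T A"
    unfolding \<psi>_def by (rule A.Zmod_times_Zr_lift_hom[OF d d_M x])
  interpret \<psi>: group_hom T A \<psi> by unfold_locales (rule \<psi>)
  have \<psi>_torsion: "\<psi> (torsion_gen M r) = d"
    unfolding \<psi>_def by (rule A.Zmod_times_Zr_lift_torsion_gen[OF d d_M x])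
  have "\<psi> (ab_gen s) = f s" if "s \<in> hgens r" for s
    using that
  proof (cases rule: hgens_cases)
    case (GX j)
    then show ?thesis
      using A.Zmod_times_Zr_lift_free_gen[OF d d_M x] by (simp add: ab_gen_def \<psi>_def)
  qed (simp_all add: ab_gen_def \<psi>.hom_nat_pow \<psi>_torsion d_a d_b)
  with \<psi> show thesis by (rule that)
qed

lemma abelianization_H: "abelianization H \<cong> T"
proof -
  let ?q = "\<lambda>h. derived H (carrier H) #>\<^bsub>H\<^esub> h"
  interpret q: group_hom H "abelianization H" ?q by (rule H.group_hom_abelianization)
  have "(\<lambda>s. ?q (H.gen s)) ` hgens r \<subseteq> carrier (abelianization H)"
    using q.hom_closed by auto
  then obtain \<psi> where \<psi>: "\<psi> \<in> hom T (abelianization H)"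
      "\<And>s. s \<in> hgens r \<Longrightarrow> \<psi> (ab_gen s) = ?q (H.gen s)"
    using T_universal[OF H.comm_group_abelianization _
        q.H_relations_hom[OF H.gen_image_closed H_relations_gen]] by blast
  obtain \<phi> where \<phi>: "group_hom H T \<phi>" "\<And>s. s \<in> hgens r \<Longrightarrow> \<phi> (H.gen s) = ab_gen s"
      "\<phi> ` carrier H = carrier T"
    by (rule H_to_T) blast
  show ?thesis
    by (rule group_hom.abelianization_isoI[OF \<phi>(1) comm_group_Zmod_times_Zr \<phi>(3)
          H.gen_image_closed H.carrier_eq_generate \<psi>(1)]) (auto simp: \<phi>(2) \<psi>(2))
qed

section \<open>\<open>H\<close> as a central extension of \<open>Q\<close>\<close>

lemma H_to_Q:
  obtains p where "group_hom H Q p" "\<And>s. s \<in> hgens r \<Longrightarrow> p (H.gen s) = Q.gen s"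
    "p ` carrier H = carrier Q"
proof -
  have "H_relations Q n m1 m2 r Q.gen"
    using Q_relations_gen by (simp add: H_relations_def flip: Q.nat_pow_pow)
  then obtain p where p: "group_hom H Q p" "\<And>s. s \<in> hgens r \<Longrightarrow> p (H.gen s) = Q.gen s"
    using H_universal[OF Q.group_axioms Q.gen_image_closed] by blast
  have "p ` H.gen ` hgens r = Q.gen ` hgens r"
    using p(2) by (simp add: image_image)
  then have "p ` carrier H = carrier Q"
    using group_hom.generate_img[OF p(1) H.gen_image_closed]
      H.carrier_eq_generate Q.carrier_eq_generate by simp
  with p show thesis by (rule that)
qed

lemma kernel_H_to_Q:
  assumes p: "group_hom H Q p" "\<And>s. s \<in> hgens r \<Longrightarrow> p (H.gen s) = Q.gen s"
  shows "kernel H Q p = range (\<lambda>k::int. z [^]\<^bsub>H\<^esub> k)" (is "_ = ?Z")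
proof -
  interpret p: group_hom H Q p by (rule p(1))
  have normal: "?Z \<lhd> H"
    by (rule H.normal_range_central_powers) (simp_all add: z_central)
  interpret HZ: group "H Mod ?Z" by (rule normal.factorgroup_is_group[OF normal])
  interpret q: group_hom H "H Mod ?Z" "\<lambda>h. ?Z #>\<^bsub>H\<^esub> h"
    by unfold_locales (rule normal.r_coset_hom_Mod[OF normal])
  have closed: "(\<lambda>s. ?Z #>\<^bsub>H\<^esub> H.gen s) ` hgens r \<subseteq> carrier (H Mod ?Z)"
    using q.hom_closed by auto
  have "z \<in> ?Z" by (rule range_eqI[of _ _ 1]) simp
  then have "?Z #>\<^bsub>H\<^esub> z = \<one>\<^bsub>H Mod ?Z\<^esub>"
    using H.coset_join2[OF _ normal_imp_subgroup[OF normal]] by simp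
  then have "(?Z #>\<^bsub>H\<^esub> \<alpha>) [^]\<^bsub>H Mod ?Z\<^esub> m1 = \<one>\<^bsub>H Mod ?Z\<^esub>" "(?Z #>\<^bsub>H\<^esub> \<beta>) [^]\<^bsub>H Mod ?Z\<^esub> m2 = \<one>\<^bsub>H Mod ?Z\<^esub>"
    using q.hom_nat_pow[of \<alpha> m1] q.hom_nat_pow[of \<beta> m2] \<beta>_pow_m2 by simp_all
  then obtain s where s: "group_hom Q (H Mod ?Z) s" "\<And>g. g \<in> hgens r \<Longrightarrow> s (Q.gen g) = ?Z #>\<^bsub>H\<^esub> H.gen g"
    by (rule Q_universal[OF HZ.group_axioms closed]) blast
  have "p (z [^]\<^bsub>H\<^esub> k) = \<one>\<^bsub>Q\<^esub>" for k :: int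
    by (simp add: p.hom_int_pow p.hom_nat_pow p(2) Q_relations_gen)
  then have "?Z \<subseteq> kernel H Q p"
    unfolding kernel_def by (intro image_subsetI) simp
  moreover have "s (p a) = ?Z #>\<^bsub>H\<^esub> a" if "a \<in> H.gen ` hgens r" for a
    using that by (elim imageE) (simp add: p(2) s(2))
  ultimately show ?thesis
    by (rule p.kernel_eqI_left_inverse_Mod[OF normal _ group_hom.homh[OF s(1)] H.gen_image_closed
          H.carrier_eq_generate])
qed

lemma cyclic_central_extension_H:
  obtains p where "cyclic_central_extension H Q p n z" "\<And>s. s \<in> hgens r \<Longrightarrow> p (H.gen s) = Q.gen s"
proof -
  obtain p where p: "group_hom H Q p" "\<And>s. s \<in> hgens r \<Longrightarrow> p (H.gen s) = Q.gen s"
      "p ` carrier H = carrier Q"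
    by (rule H_to_Q) blast
  have "cyclic_central_extension H Q p n z"
    using group_hom.homh[OF p(1)] p(3) kernel_H_to_Q[OF p(1,2)]
    by unfold_locales (simp_all add: ord_z z_central)
  then show thesis
    using p(2) by (rule that)
qed

lemma central_extension_H: "central_extension (integer_mod_group n) H Q"
proof -
  obtain p where "cyclic_central_extension H Q p n z"
    by (rule cyclic_central_extension_H) blast
  then show ?thesis
    by (rule cyclic_central_extension.central_extension)
qed

lemma iso_H_if_lifts:
  assumes ext: "cyclic_central_extension G Q \<pi> n \<zeta>"
    and f: "f ` hgens r \<subseteq> carrier G" "\<And>s. s \<in> hgens r \<Longrightarrow> \<pi> (f s) = Q.gen s"
    and pow: "f GA [^]\<^bsub>G\<^esub> m1 = \<zeta> [^]\<^bsub>G\<^esub> c" "f GB [^]\<^bsub>G\<^esub> m2 = \<zeta> [^]\<^bsub>G\<^esub> c" and c: "coprime c (int n)"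
  shows "G \<cong> H"
proof -
  interpret ext: cyclic_central_extension G Q \<pi> n \<zeta> by fact
  have "(\<zeta> [^]\<^bsub>G\<^esub> c) [^]\<^bsub>G\<^esub> n = \<one>\<^bsub>G\<^esub>"
    by (simp add: ext.G.int_pow_pow ext.z_int_pow_eq_one_iff flip: int_pow_int)
  moreover have "f GA \<in> carrier G" "\<And>i. i < r \<Longrightarrow> f (GX i) \<in> carrier G"
    using f(1) by auto
  ultimately have "H_relations G n m1 m2 r f"
    using pow by (simp add: H_relations_def ext.z_int_pow_central flip: ext.G.nat_pow_pow)
  then obtain F where F: "group_hom H G F" "\<And>s. s \<in> hgens r \<Longrightarrow> F (H.gen s) = f s"
    using H_universal[OF ext.G.group_axioms f(1)] by blast
  obtain p where p: "cyclic_central_extension H Q p n z" "\<And>s. s \<in> hgens r \<Longrightarrow> p (H.gen s) = Q.gen s"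
    by (rule cyclic_central_extension_H) blast
  interpret F: group_hom H G F by (rule F(1))
  interpret p: cyclic_central_extension H Q p n z by (rule p(1))
  interpret \<pi>F: group_hom H Q "\<pi> \<circ> F"
    by unfold_locales (rule Group.hom_compose[OF F.homh ext.hom_\<pi>])
  have "\<pi> (F h) = p h" if "h \<in> carrier H" for h
    using H.hom_eqI[OF \<pi>F.group_hom_axioms p.\<pi>.group_hom_axioms _ that] by (simp add: f(2) F(2) p(2))
  moreover have "F z = \<zeta> [^]\<^bsub>G\<^esub> c"
    using pow(1) by (simp add: F.hom_nat_pow F(2))
  ultimately have "cyclic_central_extension_hom H Q p n z G \<pi> \<zeta> F c"
    using c by unfold_locales simp_all
  then have "F \<in> iso H G"
    by (rule cyclic_central_extension_hom.iso)
  then show ?thesis using H.iso_sym is_isoI by blast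
qed

lemma H_iso_DirProd_if_coprime:
  assumes "coprime n (m1 * m2)"
  shows "H \<cong> integer_mod_group n \<times>\<times> Q"
proof -
  let ?G = "integer_mod_group n \<times>\<times> Q" and ?\<zeta> = "(1 mod int n, \<one>\<^bsub>Q\<^esub>)"
  have ext: "cyclic_central_extension ?G Q snd n ?\<zeta>"
    by (rule cyclic_central_extension_DirProd) (rule Q.group_axioms)
  interpret ext: cyclic_central_extension ?G Q snd n ?\<zeta> by (rule ext)
  define f where
    "f s = ((case s of GA \<Rightarrow> int m2 mod int n | GB \<Rightarrow> int m1 mod int n | GX i \<Rightarrow> 0), Q.gen s)" for s
  have pow: "x [^]\<^bsub>?G\<^esub> k = (int k * fst x mod int n, snd x [^]\<^bsub>Q\<^esub> k)" for x and k :: nat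
    by (induction k) (simp_all add: mult_DirProd' mod_simps distrib_right add.commute)
  have \<zeta>_pow: "?\<zeta> [^]\<^bsub>?G\<^esub> int k = (int k mod int n, \<one>\<^bsub>Q\<^esub>)" for k
    by (simp add: pow int_pow_int mod_simps)
  have "?G \<cong> H"
  proof (rule iso_H_if_lifts[OF ext, of f "int (m1 * m2)"])
    show "f ` hgens r \<subseteq> carrier ?G"
      using n_pos by (auto simp: f_def carrier_integer_mod_group split: hgen.split)
    show "snd (f s) = Q.gen s" for s
      by (simp add: f_def)
    show "coprime (int (m1 * m2)) (int n)"
      using assms by (simp only: coprime_int_iff coprime_commute)
    show "f GA [^]\<^bsub>?G\<^esub> m1 = ?\<zeta> [^]\<^bsub>?G\<^esub> int (m1 * m2)" "f GB [^]\<^bsub>?G\<^esub> m2 = ?\<zeta> [^]\<^bsub>?G\<^esub> int (m1 * m2)"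
      using Q_relations_gen unfolding \<zeta>_pow by (simp_all add: pow f_def mod_simps mult.commute)
  qed
  then show ?thesis
    using ext.G.iso_sym by blast
qed

section \<open>Uniqueness of the extension\<close>

lemma lifts_killed_imp_eq_one:
  assumes ext: "cyclic_central_extension G Q \<pi> n \<zeta>" and ab: "abelianization G \<cong> T"
    and f: "f ` hgens r \<subseteq> carrier G" "\<And>s. s \<in> hgens r \<Longrightarrow> \<pi> (f s) = Q.gen s"
    and N: "M = N * p" "n dvd N" "f GA [^]\<^bsub>G\<^esub> N = \<one>\<^bsub>G\<^esub>" "f GB [^]\<^bsub>G\<^esub> N = \<one>\<^bsub>G\<^esub>"
  shows "p = 1"
proof -
  interpret ext: cyclic_central_extension G Q \<pi> n \<zeta> by fact
  obtain \<phi> where \<phi>: "group_hom G T \<phi>" "\<phi> ` carrier G = carrier T"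
    using ext.G.abelianization_iso_imp_surj_hom[OF Zmod_times_Zr.group_axioms ab] by blast
  let ?x = "(\<lambda>i. f (GX i)) ` {..<r}" and ?Y = "{f GA, f GB, \<zeta>}"
  have "insert \<zeta> (f ` hgens r) = ?x \<union> ?Y"
    by (auto simp: hgens_def)
  moreover have "carrier Q = generate Q (\<pi> ` f ` hgens r)"
    using f(2) Q.carrier_eq_generate by (simp add: image_image)
  ultimately have gen: "?x \<union> ?Y \<subseteq> carrier G" "carrier G = generate G (?x \<union> ?Y)"
    using f(1) ext.carrier_eq_generate[of "f ` hgens r"] by auto
  have "\<zeta> [^]\<^bsub>G\<^esub> N = \<one>\<^bsub>G\<^esub>"
    using N(2) by (simp add: ext.G.pow_eq_id ext.ord_z)
  moreover have "N > 0" "p > 0"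
    using N(1) n_pos m1_pos m2_pos by (auto intro: Nat.gr0I)
  ultimately show ?thesis
    using Zmod_times_Zr_torsion_generators_imp_eq_one[OF \<phi>[unfolded N(1)] gen] N(3,4) by auto
qed

lemma lift_exponents_coprime:
  assumes ext: "cyclic_central_extension G Q \<pi> n \<zeta>" and ab: "abelianization G \<cong> T"
    and f: "f ` hgens r \<subseteq> carrier G" "\<And>s. s \<in> hgens r \<Longrightarrow> \<pi> (f s) = Q.gen s"
    and pow: "f GA [^]\<^bsub>G\<^esub> m1 = \<zeta> [^]\<^bsub>G\<^esub> (s::int)" "f GB [^]\<^bsub>G\<^esub> m2 = \<zeta> [^]\<^bsub>G\<^esub> (t::int)"
  shows "coprime s (gcd (int m1) (int n))" "coprime t (gcd (int m2) (int n))"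
proof -
  interpret ext: cyclic_central_extension G Q \<pi> n \<zeta> by fact
  have closed: "f GA \<in> carrier G" "f GB \<in> carrier G"
    using f(1) by auto
  have killed: "p = 1"
    if "M = N * p" "n dvd N" "f g [^]\<^bsub>G\<^esub> N = \<one>\<^bsub>G\<^esub>" "f g' [^]\<^bsub>G\<^esub> N = \<one>\<^bsub>G\<^esub>" "{g, g'} = {GA, GB}" for g g' N p
    using lifts_killed_imp_eq_one[OF ext ab f that(1,2)] that(3-5) by (auto simp: doubleton_eq_iff)
  have "coprime i (gcd (int m) (int n))"
    if g: "{g, g'} = {GA, GB}" and m: "m * m' = m1 * m2"
      and i: "f g [^]\<^bsub>G\<^esub> m = \<zeta> [^]\<^bsub>G\<^esub> i" "f g' [^]\<^bsub>G\<^esub> m' = \<zeta> [^]\<^bsub>G\<^esub> j" for g g' m m' and i j :: int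
  proof (rule coprime_gcd_intI)
    fix p assume p: "p dvd m" "p dvd n" "int p dvd i"
    let ?N = "n * (m div p) * m'"
    have lifts: "f g \<in> carrier G" "f g' \<in> carrier G"
      using g closed by (auto simp: doubleton_eq_iff)
    have "f g [^]\<^bsub>G\<^esub> ?N = (f g [^]\<^bsub>G\<^esub> (n * (m div p))) [^]\<^bsub>G\<^esub> m'"
      using lifts(1) by (simp add: ext.G.nat_pow_pow)
    then have g_killed: "f g [^]\<^bsub>G\<^esub> ?N = \<one>\<^bsub>G\<^esub>"
      using ext.lift_pow_eq_one[OF lifts(1) i(1) p] by simp
    have "f g' [^]\<^bsub>G\<^esub> ?N = (f g' [^]\<^bsub>G\<^esub> (n * (m' div 1))) [^]\<^bsub>G\<^esub> (m div p)"
      using lifts(2) by (simp add: ext.G.nat_pow_pow ac_simps)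
    then have g'_killed: "f g' [^]\<^bsub>G\<^esub> ?N = \<one>\<^bsub>G\<^esub>"
      using ext.lift_pow_eq_one[OF lifts(2) i(2), of 1] by simp
    have "M = n * (m * m')"
      by (simp add: m)
    also have "\<dots> = ?N * p"
      using p(1) by (simp add: ac_simps)
    finally show "p = 1"
      by (rule killed[OF _ _ g_killed g'_killed g]) simp
  qed
  from this[OF _ _ pow] this[OF _ _ pow(2,1)]
  show "coprime s (gcd (int m1) (int n))" "coprime t (gcd (int m2) (int n))"
    by (simp_all add: insert_commute mult.commute)
qed

theorem central_extension_unique:
  assumes "group G" "central_extension (integer_mod_group n) G Q" and ab: "abelianization G \<cong> T"
  shows "G \<cong> H"
proof -
  obtain \<pi> \<zeta> where ext: "cyclic_central_extension G Q \<pi> n \<zeta>"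
    using central_extension_integer_mod_group_cyclic[OF assms(1) Q.group_axioms assms(2)] .
  interpret ext: cyclic_central_extension G Q \<pi> n \<zeta> by (rule ext)
  have "\<exists>g. g \<in> carrier G \<and> \<pi> g = Q.gen s" if "s \<in> hgens r" for s
    using Q.gen_closed[OF that] ext.surj by (metis imageE)
  then obtain f where f: "\<And>s. s \<in> hgens r \<Longrightarrow> f s \<in> carrier G" "\<And>s. s \<in> hgens r \<Longrightarrow> \<pi> (f s) = Q.gen s"
    by metis
  have f_img: "f ` hgens r \<subseteq> carrier G" using f(1) by auto
  have "\<pi> (f GA [^]\<^bsub>G\<^esub> m1) = \<one>\<^bsub>Q\<^esub>" "\<pi> (f GB [^]\<^bsub>G\<^esub> m2) = \<one>\<^bsub>Q\<^esub>"
    using f Q_relations_gen by (simp_all add: ext.\<pi>.hom_nat_pow)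
  then obtain s t :: int where powers: "f GA [^]\<^bsub>G\<^esub> m1 = \<zeta> [^]\<^bsub>G\<^esub> s" "f GB [^]\<^bsub>G\<^esub> m2 = \<zeta> [^]\<^bsub>G\<^esub> t"
    using f(1) ext.kernelE by (metis GA_in_hgens GB_in_hgens ext.G.nat_pow_closed)
  obtain c where c: "coprime c (int n)" "[c = s] (mod int m1)" "[c = t] (mod int m2)"
    using exists_coprime_cong[of "int n" "int m1" "int m2" s t] n_pos coprime_m
      lift_exponents_coprime[OF ext ab f_img f(2) powers] by auto
  obtain j k where c_eq: "c = s + int m1 * j" "c = t + int m2 * k"
    using c(2,3) by (metis cong_iff_lin cong_sym mult.commute)
  define f' where "f' g = (case g of
      GA \<Rightarrow> f GA \<otimes>\<^bsub>G\<^esub> \<zeta> [^]\<^bsub>G\<^esub> j | GB \<Rightarrow> f GB \<otimes>\<^bsub>G\<^esub> \<zeta> [^]\<^bsub>G\<^esub> k | GX i \<Rightarrow> f (GX i))" for g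
  show ?thesis
  proof (rule iso_H_if_lifts[OF ext _ _ _ _ c(1)])
    show "f' ` hgens r \<subseteq> carrier G"
      using f(1) by (auto simp: f'_def split: hgen.split)
    show "\<pi> (f' g) = Q.gen g" if "g \<in> hgens r" for g
      using that f by (cases rule: hgens_cases) (simp_all add: f'_def)
    show "f' GA [^]\<^bsub>G\<^esub> m1 = \<zeta> [^]\<^bsub>G\<^esub> c" "f' GB [^]\<^bsub>G\<^esub> m2 = \<zeta> [^]\<^bsub>G\<^esub> c"
      using ext.lift_mult_pow[OF f(1)[of GA] powers(1), of j] ext.lift_mult_pow[OF f(1)[of GB] powers(2), of k]
      by (simp_all add: f'_def flip: c_eq)
  qed
qed

end

section \<open>Shift conjugation and descending products\<close>

primrec desc_prod :: "('g, 'c) monoid_scheme \<Rightarrow> (int \<Rightarrow> 'g) \<Rightarrow> nat \<Rightarrow> 'g" where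
  "desc_prod G a 0 = \<one>\<^bsub>G\<^esub>"
| "desc_prod G a (Suc k) = a (int k) \<otimes>\<^bsub>G\<^esub> desc_prod G a k"

definition shift_conj :: "('g, 'c) monoid_scheme \<Rightarrow> (int \<Rightarrow> 'g) \<Rightarrow> int \<Rightarrow> 'g \<Rightarrow> bool" where
  "shift_conj G a S \<theta> \<longleftrightarrow> (\<forall>i. a (i + S) \<otimes>\<^bsub>G\<^esub> \<theta> = \<theta> \<otimes>\<^bsub>G\<^esub> a i)"

definition conj_extension ::
  "('g, 'c) monoid_scheme \<Rightarrow> int \<Rightarrow> 'g \<Rightarrow> (int \<Rightarrow> 'g) \<Rightarrow> int \<Rightarrow> 'g" where
  "conj_extension G S \<theta> y i =
     \<theta> [^]\<^bsub>G\<^esub> (i div S) \<otimes>\<^bsub>G\<^esub> y (i mod S) \<otimes>\<^bsub>G\<^esub> inv\<^bsub>G\<^esub> (\<theta> [^]\<^bsub>G\<^esub> (i div S))"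

definition prepend_factor ::
  "('g, 'c) monoid_scheme \<Rightarrow> nat \<Rightarrow> 'g \<Rightarrow> (int \<Rightarrow> 'g) \<Rightarrow> int \<Rightarrow> 'g" where
  "prepend_factor G k c x i = (if i = 0 then inv\<^bsub>G\<^esub> (desc_prod G x k) \<otimes>\<^bsub>G\<^esub> c else x (i - 1))"

context group begin

lemma desc_prod_closed: "(\<And>i. i < k \<Longrightarrow> a (int i) \<in> carrier G) \<Longrightarrow> desc_prod G a k \<in> carrier G"
  by (induction k) auto

lemma desc_prod_cong: "(\<And>i. i < k \<Longrightarrow> a (int i) = b (int i)) \<Longrightarrow> desc_prod G a k = desc_prod G b k"
  by (induction k) auto

lemma desc_prod_Suc_shift:
  assumes "\<And>i. i \<le> k \<Longrightarrow> a (int i) \<in> carrier G"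
  shows "desc_prod G a (Suc k) = desc_prod G (\<lambda>i. a (i + 1)) k \<otimes> a 0"
  using assms
proof (induction k)
  case (Suc k)
  have "a (int k + 1) \<in> carrier G" "desc_prod G (\<lambda>i. a (i + 1)) k \<in> carrier G"
    using Suc.prems[of "Suc _"] by (auto intro!: desc_prod_closed simp: add.commute)
  moreover have "a 0 \<in> carrier G"
    using Suc.prems[of 0] by simp
  ultimately show ?case
    using Suc by (simp add: m_assoc add.commute)
qed simp

lemma shift_conj_zero: "shift_conj G a 0 \<theta> \<longleftrightarrow> (\<forall>i. \<theta> \<otimes> a i = a i \<otimes> \<theta>)"
  by (auto simp: shift_conj_def)

context
  fixes a :: "int \<Rightarrow> 'a"
  assumes a: "\<And>i. a i \<in> carrier G"
begin

lemma shift_conj_add: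
  assumes "\<theta> \<in> carrier G" "\<eta> \<in> carrier G" and shift: "shift_conj G a S \<theta>" "shift_conj G a S' \<eta>"
  shows "shift_conj G a (S + S') (\<theta> \<otimes> \<eta>)"
  unfolding shift_conj_def
proof
  fix i
  have "a (i + (S + S')) \<otimes> (\<theta> \<otimes> \<eta>) = (a ((i + S') + S) \<otimes> \<theta>) \<otimes> \<eta>"
    using a assms(1,2) by (simp add: m_assoc ac_simps)
  also have "\<dots> = \<theta> \<otimes> (a (i + S') \<otimes> \<eta>)"
    using a assms(1,2) shift(1) by (simp add: shift_conj_def m_assoc)
  also have "\<dots> = (\<theta> \<otimes> \<eta>) \<otimes> a i"
    using a assms(1,2) shift(2) by (simp add: shift_conj_def m_assoc)
  finally show "a (i + (S + S')) \<otimes> (\<theta> \<otimes> \<eta>) = (\<theta> \<otimes> \<eta>) \<otimes> a i" .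
qed

lemma shift_conj_inv:
  assumes "\<theta> \<in> carrier G" and shift: "shift_conj G a S \<theta>"
  shows "shift_conj G a (- S) (inv \<theta>)"
  unfolding shift_conj_def
proof
  fix i
  have "a (i + - S) \<otimes> inv \<theta> = inv \<theta> \<otimes> (\<theta> \<otimes> a (i + - S)) \<otimes> inv \<theta>"
    using a assms(1) by (simp flip: m_assoc)
  also have "\<theta> \<otimes> a (i + - S) = a i \<otimes> \<theta>"
    using shift[unfolded shift_conj_def, rule_format, of "i + - S"] by simp
  also have "inv \<theta> \<otimes> (a i \<otimes> \<theta>) \<otimes> inv \<theta> = inv \<theta> \<otimes> a i"
    using a assms(1) by (simp add: m_assoc)
  finally show "a (i + - S) \<otimes> inv \<theta> = inv \<theta> \<otimes> a i" .
qed

lemma shift_conj_nat_pow: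
  assumes "\<theta> \<in> carrier G" "shift_conj G a S \<theta>"
  shows "shift_conj G a (int j * S) (\<theta> [^] j)"
proof (induction j)
  case 0
  then show ?case using a by (simp add: shift_conj_zero)
next
  case (Suc j)
  then show ?case
    using shift_conj_add[OF _ assms(1) Suc.IH assms(2)] assms(1)
    by (simp add: distrib_right add.commute)
qed

lemma shift_conj_int_pow:
  assumes "\<theta> \<in> carrier G" "shift_conj G a S \<theta>"
  shows "shift_conj G a (j * S) (\<theta> [^] j)"
proof (cases j rule: int_cases2)
  case (nonneg k)
  then show ?thesis using shift_conj_nat_pow[OF assms] by (simp add: int_pow_int)
next
  case (nonpos k)
  then show ?thesis
    using shift_conj_inv[OF _ shift_conj_nat_pow[OF assms]] assms(1) by (simp add: int_pow_neg_int)
qed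

lemma desc_prod_add_mult:
  assumes \<theta>: "\<theta> \<in> carrier G" "shift_conj G a (int S) \<theta>"
    and e: "e \<in> carrier G" "desc_prod G a S = \<theta> \<otimes> e"
  shows "desc_prod G a (k + j * S) = \<theta> [^] j \<otimes> desc_prod G a k \<otimes> e [^] j"
proof -
  have closed: "desc_prod G a k \<in> carrier G" for k
    using a by (simp add: desc_prod_closed)
  have add: "desc_prod G a (k + S) = \<theta> \<otimes> desc_prod G a k \<otimes> e" for k
  proof (induction k)
    case (Suc k)
    have "desc_prod G a (Suc k + S) = (a (int k + int S) \<otimes> \<theta>) \<otimes> desc_prod G a k \<otimes> e"
      using Suc a \<theta>(1) e(1) closed by (simp add: m_assoc)
    also have "\<dots> = \<theta> \<otimes> desc_prod G a (Suc k) \<otimes> e"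
      using a \<theta> e(1) closed by (simp add: shift_conj_def m_assoc)
    finally show ?case .
  qed (use \<theta> e in simp)
  show ?thesis
  proof (induction j)
    case (Suc j)
    have "desc_prod G a (k + Suc j * S) = \<theta> \<otimes> desc_prod G a (k + j * S) \<otimes> e"
      using add[of "k + j * S"] by (simp add: ac_simps)
    also have "\<dots> = (\<theta> \<otimes> \<theta> [^] j) \<otimes> desc_prod G a k \<otimes> (e [^] j \<otimes> e)"
      using Suc \<theta>(1) e(1) closed by (simp add: m_assoc)
    also have "\<theta> \<otimes> \<theta> [^] j = \<theta> [^] Suc j"
      using \<theta>(1) nat_pow_Suc2 by metis
    finally show ?case by simp
  qed (use closed in simp)
qed

lemma conj_extension_self:
  assumes "\<theta> \<in> carrier G" "shift_conj G a S \<theta>"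
  shows "conj_extension G S \<theta> a = a"
proof
  fix i
  have "\<theta> [^] (i div S) \<otimes> a (i mod S) = a (i mod S + i div S * S) \<otimes> \<theta> [^] (i div S)"
    using shift_conj_int_pow[OF assms] unfolding shift_conj_def by metis
  then show "conj_extension G S \<theta> a i = a i"
    using a assms(1) by (simp add: conj_extension_def m_assoc)
qed

lemma prepend_factor_self: "prepend_factor G k (desc_prod G a (Suc k)) (\<lambda>i. a (i + 1)) = a"
proof
  fix i
  have "desc_prod G (\<lambda>i. a (i + 1)) k \<in> carrier G"
    using a by (simp add: desc_prod_closed)
  then show "prepend_factor G k (desc_prod G a (Suc k)) (\<lambda>i. a (i + 1)) i = a i"
    unfolding desc_prod_Suc_shift[OF a]
    using a by (simp add: prepend_factor_def flip: m_assoc)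
qed

end

lemma conj_extension_closed:
  assumes "S > 0" "\<theta> \<in> carrier G" "\<And>i. 0 \<le> i \<Longrightarrow> i < S \<Longrightarrow> y i \<in> carrier G"
  shows "conj_extension G S \<theta> y i \<in> carrier G"
  using assms by (simp add: conj_extension_def)

lemma conj_extension_eq:
  assumes "0 \<le> i" "i < S" "y i \<in> carrier G"
  shows "conj_extension G S \<theta> y i = y i"
  using assms by (simp add: conj_extension_def)

lemma conj_extension_cong:
  assumes "S > 0" "\<And>i. 0 \<le> i \<Longrightarrow> i < S \<Longrightarrow> y i = y' i"
  shows "conj_extension G S \<theta> y = conj_extension G S \<theta> y'"
  using assms by (auto simp: conj_extension_def)

lemma shift_conj_conj_extension:
  assumes "S > 0" and \<theta>: "\<theta> \<in> carrier G" and y: "\<And>i. 0 \<le> i \<Longrightarrow> i < S \<Longrightarrow> y i \<in> carrier G"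
  shows "shift_conj G (conj_extension G S \<theta> y) S \<theta>"
  unfolding shift_conj_def
proof
  fix i
  have "\<theta> [^] ((i + S) div S) = \<theta> \<otimes> \<theta> [^] (i div S)"
    using \<open>S > 0\<close> \<theta> int_pow_mult[of \<theta> 1 "i div S"] by (simp add: add.commute)
  moreover have "y (i mod S) \<in> carrier G"
    using y \<open>S > 0\<close> by simp
  ultimately show "conj_extension G S \<theta> y (i + S) \<otimes> \<theta> = \<theta> \<otimes> conj_extension G S \<theta> y i"
    using \<theta> by (simp add: conj_extension_def inv_mult_group m_assoc)
qed

lemma prepend_factor_closed:
  assumes "\<And>j. 0 \<le> j \<Longrightarrow> j < int k \<Longrightarrow> x j \<in> carrier G" "c \<in> carrier G" "0 \<le> i" "i \<le> int k"
  shows "prepend_factor G k c x i \<in> carrier G"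
  using assms by (simp add: prepend_factor_def desc_prod_closed)

lemma desc_prod_prepend_factor:
  assumes x: "\<And>j. 0 \<le> j \<Longrightarrow> j < int k \<Longrightarrow> x j \<in> carrier G" and c: "c \<in> carrier G"
  shows "desc_prod G (prepend_factor G k c x) (Suc k) = c"
proof -
  have "desc_prod G (prepend_factor G k c x) (Suc k)
      = desc_prod G (\<lambda>i. prepend_factor G k c x (i + 1)) k \<otimes> prepend_factor G k c x 0"
    using x c by (intro desc_prod_Suc_shift prepend_factor_closed) simp_all
  also have "desc_prod G (\<lambda>i. prepend_factor G k c x (i + 1)) k = desc_prod G x k"
    by (rule desc_prod_cong) (simp add: prepend_factor_def)
  also have "desc_prod G x k \<otimes> prepend_factor G k c x 0 = c"
    using x c desc_prod_closed[of k x] by (simp add: prepend_factor_def flip: m_assoc)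
  finally show ?thesis .
qed

lemma prepend_factor_cong:
  assumes "\<And>j. 0 \<le> j \<Longrightarrow> j < int k \<Longrightarrow> x j = x' j" "0 \<le> i" "i \<le> int k"
  shows "prepend_factor G k c x i = prepend_factor G k c x' i"
  using assms desc_prod_cong[of k x x'] by (simp add: prepend_factor_def)

end

context group_hom begin

lemma hom_desc_prod:
  assumes "\<And>i. i < k \<Longrightarrow> a (int i) \<in> carrier G"
  shows "h (desc_prod G a k) = desc_prod H (\<lambda>i. h (a i)) k"
  using assms by (induction k) (simp_all add: G.desc_prod_closed)

lemma hom_conj_extension:
  assumes "S > 0" "\<theta> \<in> carrier G" "\<And>i. 0 \<le> i \<Longrightarrow> i < S \<Longrightarrow> y i \<in> carrier G"
  shows "h (conj_extension G S \<theta> y i) = conj_extension H S (h \<theta>) (\<lambda>i. h (y i)) i"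
  using assms by (simp add: conj_extension_def hom_int_pow)

lemma hom_prepend_factor:
  assumes "\<And>j. 0 \<le> j \<Longrightarrow> j < int k \<Longrightarrow> x j \<in> carrier G" "c \<in> carrier G" "0 \<le> i" "i \<le> int k"
  shows "h (prepend_factor G k c x i) = prepend_factor H k (h c) (\<lambda>i. h (x i)) i"
  using assms by (simp add: prepend_factor_def G.desc_prod_closed hom_desc_prod)

end

section \<open>Oka's group\<close>

definition oka_relators :: "nat \<Rightarrow> nat \<Rightarrow> nat \<Rightarrow> (okagen \<times> bool) list set" where
  "oka_relators p q e =
     {winv (wgen Om) @ concat (map (\<lambda>j. wgen (OA (int j))) (rev [0..<p])),
       wpow (wgen Om) e}
      \<union> {wgen (OA i) @ winv (wgen (OA (i + int q))) | i. True}
      \<union> {wgen (OA (i + int p)) @ wgen Om @ winv (wgen (OA i)) @ winv (wgen Om) | i. True}"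

lemma presentation_oka_group: "presentation (oka_group p q e) UNIV (oka_relators p q e)"
  by unfold_locales (simp_all add: oka_group_def oka_relators_def)

definition oka_relations ::
  "('g, 'c) monoid_scheme \<Rightarrow> nat \<Rightarrow> nat \<Rightarrow> nat \<Rightarrow> 'g \<Rightarrow> (int \<Rightarrow> 'g) \<Rightarrow> bool" where
  "oka_relations G p q e \<omega> a \<longleftrightarrow> desc_prod G a p = \<omega> \<and> \<omega> [^]\<^bsub>G\<^esub> e = \<one>\<^bsub>G\<^esub> \<and>
     shift_conj G a (int q) \<one>\<^bsub>G\<^esub> \<and> shift_conj G a (int p) \<omega>"

lemma (in group) weval_oka_relators:
  assumes f: "range f \<subseteq> carrier G"
  shows "(\<forall>w\<in>oka_relators p q e. weval G f w = \<one>) \<longleftrightarrow> oka_relations G p q e (f Om) (\<lambda>i. f (OA i))"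
proof -
  have f_closed: "f s \<in> carrier G" for s
    using f by auto
  let ?P = "desc_prod G (\<lambda>i. f (OA i)) p"
  have P_closed: "?P \<in> carrier G"
    using f_closed by (simp add: desc_prod_closed)
  note weval_word = weval_append[OF f] weval_winv[OF f] weval_wpow[OF f] weval_wgen
  have "weval G f (concat (map (\<lambda>j. wgen (OA (int j))) (rev [0..<k])))
      = desc_prod G (\<lambda>i. f (OA i)) k" for k
    using f_closed by (induction k) (simp_all add: weval_word)
  then have product: "weval G f
        (winv (wgen Om) @ concat (map (\<lambda>j. wgen (OA (int j))) (rev [0..<p]))) = \<one>
      \<longleftrightarrow> ?P = f Om"
    using f_closed P_closed by (simp add: weval_word inv_solve_left')
  have power: "weval G f (wpow (wgen Om) e) = f Om [^] e"
    using f_closed by (simp add: weval_word)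
  have periodic: "weval G f (wgen (OA i) @ winv (wgen (OA (i + int q)))) = \<one>
      \<longleftrightarrow> f (OA (i + int q)) \<otimes> \<one> = \<one> \<otimes> f (OA i)" for i
    using f_closed by (auto simp: weval_word eq_iff_mult_inv_eq_one)
  have conjugate: "weval G f
        (wgen (OA (i + int p)) @ wgen Om @ winv (wgen (OA i)) @ winv (wgen Om)) = \<one>
      \<longleftrightarrow> f (OA (i + int p)) \<otimes> f Om = f Om \<otimes> f (OA i)" for i
  proof -
    have "weval G f (wgen (OA (i + int p)) @ wgen Om @ winv (wgen (OA i)) @ winv (wgen Om))
        = (f (OA (i + int p)) \<otimes> f Om) \<otimes> inv (f Om \<otimes> f (OA i))"
      using f_closed by (simp add: weval_word m_assoc inv_mult_group)
    then show ?thesis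
      using f_closed by (simp add: eq_iff_mult_inv_eq_one)
  qed
  show ?thesis
    unfolding oka_relators_def oka_relations_def shift_conj_def
      product[symmetric] power[symmetric] periodic[symmetric] conjugate[symmetric] by blast
qed

lemma oka_group_universal:
  assumes K: "group K" and \<omega>: "\<omega> \<in> carrier K" and a: "\<And>i. a i \<in> carrier K"
    and rel: "oka_relations K p q e \<omega> a"
  obtains h where "group_hom (oka_group p q e) K h"
    "h (presentation.gen UNIV (oka_relators p q e) Om) = \<omega>"
    "\<And>i. h (presentation.gen UNIV (oka_relators p q e) (OA i)) = a i"
proof -
  let ?f = "case_okagen \<omega> a"
  have f: "range ?f \<subseteq> carrier K"
    using \<omega> a by (auto split: okagen.splits)
  have "weval K ?f w = \<one>\<^bsub>K\<^esub>" if "w \<in> oka_relators p q e" for w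
    using group.weval_oka_relators[OF K f] rel that by fastforce
  then obtain h where "group_hom (oka_group p q e) K h"
      "\<And>s. h (presentation.gen UNIV (oka_relators p q e) s) = ?f s"
    by (rule presentation.von_Dyck[OF presentation_oka_group K f]) auto
  then show thesis
    by (intro that[of h]) simp_all
qed

locale bezout_parameters = coprime_parameters +
  fixes u w :: nat
  assumes bezout: "u * m1 = w * m2 + 1"
begin

definition R :: nat where "R = r + 1"
definition p :: nat where "p = R * m1"
definition q :: nat where "q = R * m2"

lemma R_pos: "int R > 0"
  by (simp add: R_def)

lemma u_mult_p: "u * p = R + w * q"
proof -
  have "u * p = (u * m1) * R" by (simp add: p_def)
  then show ?thesis unfolding bezout by (simp add: q_def algebra_simps)
qed

end

locale oka_solution = bezout_parameters + G: group G for G :: "('g, 'c) monoid_scheme" (structure) +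
  fixes \<omega> :: 'g and a :: "int \<Rightarrow> 'g"
  assumes \<omega>_closed [simp]: "\<omega> \<in> carrier G" and a_closed [simp]: "\<And>i. a i \<in> carrier G"
    and oka: "oka_relations G p q (n * m2) \<omega> a"
begin

definition \<sigma> :: 'g where "\<sigma> = desc_prod G a q"

lemma \<sigma>_closed [simp]: "\<sigma> \<in> carrier G"
  by (simp add: \<sigma>_def G.desc_prod_closed)

lemma desc_prod_a_closed [simp]: "desc_prod G a k \<in> carrier G"
  by (simp add: G.desc_prod_closed)

lemma desc_prod_p: "desc_prod G a p = \<omega>"
  and \<omega>_pow: "\<omega> [^] (n * m2) = \<one>"
  and shift_conj_q: "shift_conj G a (int q) \<one>"
  and shift_conj_p: "shift_conj G a (int p) \<omega>"
  using oka unfolding oka_relations_def by blast+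

lemma desc_prod_mult_p: "desc_prod G a (j * p) = \<omega> [^] j"
  using G.desc_prod_add_mult[OF a_closed \<omega>_closed shift_conj_p G.one_closed, of 0 j] desc_prod_p
  by simp

lemma desc_prod_add_mult_q: "desc_prod G a (k + j * q) = desc_prod G a k \<otimes> \<sigma> [^] j"
  using G.desc_prod_add_mult[OF a_closed G.one_closed shift_conj_q \<sigma>_closed, of k j]
  by (simp add: \<sigma>_def)

lemma \<sigma>_pow_m1: "\<sigma> [^] m1 = \<omega> [^] m2"
proof -
  have "m1 * q = m2 * p" by (simp add: p_def q_def)
  then show ?thesis
    using desc_prod_add_mult_q[of 0 m1] desc_prod_mult_p[of m2] by simp
qed

lemma shift_conj_mult_q: "shift_conj G a (j * int q) \<one>"
  using G.shift_conj_int_pow[OF a_closed G.one_closed shift_conj_q, of j] by simp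

lemma shift_conj_mult_p: "shift_conj G a (int j * int p) (\<omega> [^] j)"
  using G.shift_conj_nat_pow[OF a_closed \<omega>_closed shift_conj_p] .

lemma \<omega>_pow_m2_central: "\<omega> [^] m2 \<otimes> a i = a i \<otimes> \<omega> [^] m2"
proof -
  have "shift_conj G a (int m2 * int p + - int m1 * int q) (\<omega> [^] m2 \<otimes> \<one>)"
    by (intro G.shift_conj_add shift_conj_mult_p shift_conj_mult_q) simp_all
  moreover have "int m2 * int p + - int m1 * int q = 0"
    by (simp add: p_def q_def)
  ultimately show ?thesis
    by (simp add: G.shift_conj_zero)
qed

lemma shift_conj_R: "shift_conj G a (int R) (\<omega> [^] u)"
proof -
  have "shift_conj G a (int u * int p + - int w * int q) (\<omega> [^] u \<otimes> \<one>)"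
    by (intro G.shift_conj_add shift_conj_mult_p shift_conj_mult_q) simp_all
  moreover have "int u * int p + - int w * int q = int R"
    using arg_cong[OF u_mult_p, of int] by simp
  ultimately show ?thesis by simp
qed

lemma desc_prod_R: "desc_prod G a R = \<omega> [^] u \<otimes> inv (\<sigma> [^] w)"
proof -
  have "desc_prod G a R \<otimes> \<sigma> [^] w = \<omega> [^] u"
    using desc_prod_add_mult_q[of R w] desc_prod_mult_p[of u] u_mult_p by simp
  then show ?thesis
    by (simp add: G.inv_solve_right)
qed

lemma a_eq_conj_extension:
  "a = conj_extension G (int R) (\<omega> [^] u)
         (prepend_factor G r (\<omega> [^] u \<otimes> inv (\<sigma> [^] w)) (\<lambda>i. a (i + 1)))"
proof -
  have "prepend_factor G r (\<omega> [^] u \<otimes> inv (\<sigma> [^] w)) (\<lambda>i. a (i + 1)) = a"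
    using G.prepend_factor_self[where a = a and k = r] desc_prod_R by (simp add: R_def)
  then show ?thesis
    using G.conj_extension_self[OF a_closed _ shift_conj_R] by simp
qed

definition H_image :: "hgen \<Rightarrow> 'g" where
  "H_image s = (case s of GA \<Rightarrow> \<sigma> | GB \<Rightarrow> \<omega> | GX j \<Rightarrow> a (int j + 1))"

lemma H_image_closed: "H_image ` hgens r \<subseteq> carrier G"
  by (auto simp: H_image_def split: hgen.split)

lemma H_relations_H_image: "H_relations G n m1 m2 r H_image"
proof -
  have "\<sigma> [^] (m1 * n) = \<omega> [^] (n * m2)"
    by (simp add: \<sigma>_pow_m1 mult.commute[of n] flip: G.nat_pow_pow)
  then have "\<sigma> [^] (m1 * n) = \<one>"
    by (simp add: \<omega>_pow)
  then show ?thesis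
    by (simp add: H_relations_def H_image_def \<sigma>_pow_m1 \<omega>_pow_m2_central)
qed

end

context bezout_parameters begin

definition x_seq :: "int \<Rightarrow> (hgen \<times> bool) list set" where
  "x_seq i = H.gen (GX (nat i))"

definition \<theta> :: "(hgen \<times> bool) list set" where
  "\<theta> = \<beta> [^]\<^bsub>H\<^esub> u"

definition oka_block :: "int \<Rightarrow> (hgen \<times> bool) list set" where
  "oka_block = prepend_factor H r (\<theta> \<otimes>\<^bsub>H\<^esub> inv\<^bsub>H\<^esub> (\<alpha> [^]\<^bsub>H\<^esub> w)) x_seq"

definition oka_seq :: "int \<Rightarrow> (hgen \<times> bool) list set" where
  "oka_seq = conj_extension H (int R) \<theta> oka_block"

lemma x_seq_closed: "0 \<le> i \<Longrightarrow> i < int r \<Longrightarrow> x_seq i \<in> carrier H"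
  by (simp add: x_seq_def nat_less_iff)

lemma \<theta>_closed [simp]: "\<theta> \<in> carrier H"
  by (simp add: \<theta>_def)

lemma oka_block_closed: "0 \<le> i \<Longrightarrow> i < int R \<Longrightarrow> oka_block i \<in> carrier H"
  unfolding oka_block_def by (rule H.prepend_factor_closed) (simp_all add: x_seq_closed R_def)

lemma oka_seq_closed [simp]: "oka_seq i \<in> carrier H"
  unfolding oka_seq_def using R_pos oka_block_closed by (simp add: H.conj_extension_closed)

lemma oka_seq_eq_block: "0 \<le> i \<Longrightarrow> i < int R \<Longrightarrow> oka_seq i = oka_block i"
  unfolding oka_seq_def by (simp add: H.conj_extension_eq oka_block_closed)

lemma shift_conj_oka_seq_R: "shift_conj H oka_seq (int R) \<theta>"
  unfolding oka_seq_def using R_pos oka_block_closed by (simp add: H.shift_conj_conj_extension)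

lemma desc_prod_oka_seq_R: "desc_prod H oka_seq R = \<theta> \<otimes>\<^bsub>H\<^esub> inv\<^bsub>H\<^esub> (\<alpha> [^]\<^bsub>H\<^esub> w)"
proof -
  have "desc_prod H oka_seq R = desc_prod H oka_block (Suc r)"
    using H.desc_prod_cong[of R oka_seq oka_block] oka_seq_eq_block by (simp add: R_def)
  also have "\<dots> = \<theta> \<otimes>\<^bsub>H\<^esub> inv\<^bsub>H\<^esub> (\<alpha> [^]\<^bsub>H\<^esub> w)"
    unfolding oka_block_def by (rule H.desc_prod_prepend_factor) (simp_all add: x_seq_closed)
  finally show ?thesis .
qed

lemma desc_prod_oka_seq_mult_R:
  "desc_prod H oka_seq (j * R) = \<beta> [^]\<^bsub>H\<^esub> (u * j) \<otimes>\<^bsub>H\<^esub> inv\<^bsub>H\<^esub> (\<alpha> [^]\<^bsub>H\<^esub> (w * j))"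
  using H.desc_prod_add_mult[OF oka_seq_closed \<theta>_closed shift_conj_oka_seq_R _
      desc_prod_oka_seq_R, of 0 j]
  by (simp add: \<theta>_def H.nat_pow_pow flip: H.nat_pow_inv)

lemma \<beta>_pow_mult_m2: "\<beta> [^]\<^bsub>H\<^esub> (m2 * k) = z [^]\<^bsub>H\<^esub> k"
  by (simp add: \<beta>_pow_m2 flip: H.nat_pow_pow)

lemma \<alpha>_pow_mult_m1: "\<alpha> [^]\<^bsub>H\<^esub> (m1 * k) = z [^]\<^bsub>H\<^esub> k"
  by (simp flip: H.nat_pow_pow)

lemma \<beta>_pow_u_mult_m1: "\<beta> [^]\<^bsub>H\<^esub> (u * m1) = \<beta> \<otimes>\<^bsub>H\<^esub> z [^]\<^bsub>H\<^esub> w"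
proof -
  have "u * m1 = 1 + m2 * w"
    using bezout by (simp add: mult.commute)
  then have "\<beta> [^]\<^bsub>H\<^esub> (u * m1) = \<beta> [^]\<^bsub>H\<^esub> (1::nat) \<otimes>\<^bsub>H\<^esub> \<beta> [^]\<^bsub>H\<^esub> (m2 * w)"
    by (simp only: H.nat_pow_mult H.gen_closed GB_in_hgens)
  then show ?thesis
    by (simp add: \<beta>_pow_mult_m2)
qed

lemma desc_prod_oka_seq_p: "desc_prod H oka_seq p = \<beta>"
  using desc_prod_oka_seq_mult_R[of m1]
  by (simp add: p_def \<beta>_pow_u_mult_m1 \<alpha>_pow_mult_m1 H.m_assoc mult.commute[of R] mult.commute[of w])

lemma desc_prod_oka_seq_q: "desc_prod H oka_seq q = \<alpha>"
proof -
  have "\<beta> [^]\<^bsub>H\<^esub> (u * m2) = \<alpha> [^]\<^bsub>H\<^esub> (1 + w * m2)"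
    using \<beta>_pow_mult_m2[of u] \<alpha>_pow_mult_m1[of u] bezout by (simp add: mult.commute)
  also have "\<dots> = \<alpha> \<otimes>\<^bsub>H\<^esub> \<alpha> [^]\<^bsub>H\<^esub> (w * m2)"
    using H.nat_pow_mult[of \<alpha> 1 "w * m2"] by simp
  finally show ?thesis
    using desc_prod_oka_seq_mult_R[of m2] by (simp add: q_def H.m_assoc mult.commute[of R])
qed

lemma z_pow_central: "x \<in> carrier H \<Longrightarrow> z [^]\<^bsub>H\<^esub> (k::nat) \<otimes>\<^bsub>H\<^esub> x = x \<otimes>\<^bsub>H\<^esub> z [^]\<^bsub>H\<^esub> k"
  by (simp add: H.group_commutes_pow z_central)

lemma shift_conj_oka_seq_cancel:
  assumes "y \<in> carrier H" "shift_conj H oka_seq S (y \<otimes>\<^bsub>H\<^esub> z [^]\<^bsub>H\<^esub> (k::nat))"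
  shows "shift_conj H oka_seq S y"
proof -
  have "shift_conj H oka_seq 0 (z [^]\<^bsub>H\<^esub> k)"
    by (simp add: H.shift_conj_zero z_pow_central)
  then have "shift_conj H oka_seq (S + - 0) (y \<otimes>\<^bsub>H\<^esub> z [^]\<^bsub>H\<^esub> k \<otimes>\<^bsub>H\<^esub> inv\<^bsub>H\<^esub> (z [^]\<^bsub>H\<^esub> k))"
    using assms by (intro H.shift_conj_add H.shift_conj_inv) simp_all
  then show ?thesis
    using assms(1) by (simp add: H.m_assoc)
qed

lemma oka_relations_oka_seq: "oka_relations H p q (n * m2) \<beta> oka_seq"
proof -
  have "shift_conj H oka_seq (int q) (\<one>\<^bsub>H\<^esub> \<otimes>\<^bsub>H\<^esub> z [^]\<^bsub>H\<^esub> u)"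
    using H.shift_conj_nat_pow[OF oka_seq_closed \<theta>_closed shift_conj_oka_seq_R, of m2]
    by (simp add: \<theta>_def H.nat_pow_pow q_def mult.commute \<beta>_pow_mult_m2)
  then have "shift_conj H oka_seq (int q) \<one>\<^bsub>H\<^esub>"
    by (rule shift_conj_oka_seq_cancel[rotated]) simp
  moreover have "shift_conj H oka_seq (int p) (\<beta> \<otimes>\<^bsub>H\<^esub> z [^]\<^bsub>H\<^esub> w)"
    using H.shift_conj_nat_pow[OF oka_seq_closed \<theta>_closed shift_conj_oka_seq_R, of m1]
    by (simp add: \<theta>_def H.nat_pow_pow p_def mult.commute[of R] \<beta>_pow_u_mult_m1)
  then have "shift_conj H oka_seq (int p) \<beta>"
    by (rule shift_conj_oka_seq_cancel[rotated]) simp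
  moreover have "\<beta> [^]\<^bsub>H\<^esub> (n * m2) = \<one>\<^bsub>H\<^esub>"
    using \<beta>_pow_mult_m2[of n] z_pow_n by (simp only: mult.commute)
  ultimately show ?thesis
    by (simp add: oka_relations_def desc_prod_oka_seq_p)
qed

lemma (in oka_solution) hom_oka_seq:
  assumes "group_hom H G \<Psi>" "\<And>s. s \<in> hgens r \<Longrightarrow> \<Psi> (H.gen s) = H_image s"
  shows "\<Psi> (oka_seq i) = a i"
proof -
  interpret \<Psi>: group_hom H G \<Psi> by fact
  let ?c = "\<omega> [^] u \<otimes> inv (\<sigma> [^] w)"
  have \<Psi>_x_seq: "\<Psi> (x_seq j) = a (j + 1)" if "0 \<le> j" "j < int r" for j
    using assms(2)[of "GX (nat j)"] that by (simp add: x_seq_def H_image_def nat_less_iff)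
  have \<Psi>_\<theta>: "\<Psi> \<theta> = \<omega> [^] u" and \<Psi>_c: "\<Psi> (\<theta> \<otimes>\<^bsub>H\<^esub> inv\<^bsub>H\<^esub> (\<alpha> [^]\<^bsub>H\<^esub> w)) = ?c"
    using assms(2)[of GA] assms(2)[of GB] by (simp_all add: \<theta>_def \<Psi>.hom_nat_pow H_image_def)
  have \<Psi>_block: "\<Psi> (oka_block j) = prepend_factor G r ?c (\<lambda>i. a (i + 1)) j"
    if "0 \<le> j" "j < int R" for j
  proof -
    have "\<Psi> (oka_block j) = prepend_factor G r ?c (\<lambda>i. \<Psi> (x_seq i)) j"
      unfolding oka_block_def \<Psi>_c[symmetric]
      by (rule \<Psi>.hom_prepend_factor) (use that x_seq_closed in \<open>simp_all add: R_def\<close>)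
    also have "\<dots> = prepend_factor G r ?c (\<lambda>i. a (i + 1)) j"
      by (rule G.prepend_factor_cong) (use that \<Psi>_x_seq in \<open>simp_all add: R_def\<close>)
    finally show ?thesis .
  qed
  have "\<Psi> (oka_seq i) = conj_extension G (int R) (\<omega> [^] u) (\<lambda>j. \<Psi> (oka_block j)) i"
    unfolding oka_seq_def \<Psi>_\<theta>[symmetric]
    by (rule \<Psi>.hom_conj_extension[OF R_pos \<theta>_closed oka_block_closed])
  also have "conj_extension G (int R) (\<omega> [^] u) (\<lambda>j. \<Psi> (oka_block j))
      = conj_extension G (int R) (\<omega> [^] u) (prepend_factor G r ?c (\<lambda>i. a (i + 1)))"
    by (rule G.conj_extension_cong[OF R_pos \<Psi>_block])
  also have "\<dots> = a"
    by (rule a_eq_conj_extension[symmetric])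
  finally show ?thesis .
qed

lemma H_iso_oka_group: "H \<cong> oka_group p q (n * m2)"
proof -
  let ?K = "oka_group p q (n * m2)"
  interpret K: presentation ?K UNIV "oka_relators p q (n * m2)"
    by (rule presentation_oka_group)
  have range_gen: "range K.gen \<subseteq> carrier ?K" by (rule K.gen_image_closed)
  have "oka_relations ?K p q (n * m2) (K.gen Om) (\<lambda>i. K.gen (OA i))"
    using K.weval_oka_relators[OF range_gen] K.weval_relator by blast
  then interpret K: oka_solution n m1 m2 r u w ?K "K.gen Om" "\<lambda>i. K.gen (OA i)"
    by unfold_locales simp_all
  obtain \<Psi> where \<Psi>: "group_hom H ?K \<Psi>" "\<And>s. s \<in> hgens r \<Longrightarrow> \<Psi> (H.gen s) = K.H_image s"
    by (rule H_universal[OF K.group_axioms K.H_image_closed K.H_relations_H_image]) blast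
  obtain \<Phi> where \<Phi>: "group_hom ?K H \<Phi>" "\<Phi> (K.gen Om) = \<beta>" "\<And>i. \<Phi> (K.gen (OA i)) = oka_seq i"
    by (rule oka_group_universal[OF H.group_axioms _ oka_seq_closed oka_relations_oka_seq]) auto
  have "\<Phi> (\<Psi> (H.gen s)) = H.gen s" if "s \<in> hgens r" for s
    using that
  proof (cases rule: hgens_cases)
    case GA
    then show ?thesis
      using \<Psi>(2)[OF that] group_hom.hom_desc_prod[OF \<Phi>(1), of q "\<lambda>i. K.gen (OA i)"]
      by (simp add: K.H_image_def K.\<sigma>_def \<Phi>(3) desc_prod_oka_seq_q)
  next
    case GB
    then show ?thesis using \<Psi>(2)[OF that] by (simp add: K.H_image_def \<Phi>(2))
  next
    case (GX j)
    then show ?thesis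
      using \<Psi>(2)[OF that] oka_seq_eq_block[of "int j + 1"]
      by (simp add: K.H_image_def \<Phi>(3) R_def oka_block_def prepend_factor_def x_seq_def)
  qed
  moreover have "\<Psi> (\<Phi> (K.gen s)) = K.gen s" for s
    using \<Psi>(2)[of GB] K.hom_oka_seq[OF \<Psi>] by (cases s) (simp_all add: \<Phi>(2,3) K.H_image_def)
  ultimately have "group_isomorphisms H ?K \<Psi> \<Phi>"
    by (intro group_isomorphisms_if_inverse_on_generators[OF \<Psi>(1) \<Phi>(1)
          H.gen_image_closed H.carrier_eq_generate _ range_gen K.carrier_eq_generate]) auto
  then show ?thesis
    using group_isomorphisms_imp_iso is_isoI by blast
qed

end

lemma (in coprime_parameters) H_iso_oka: "H \<cong> oka_group ((r + 1) * m1) ((r + 1) * m2) (n * m2)"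
proof -
  obtain d u w where "d dvd m1" "d dvd m2" "m1 * u = m2 * w + d"
    using bezout_add_strong_nat[of m1 m2] m1_pos by auto
  moreover from this have "d = 1"
    using coprime_m coprime_common_divisor_nat by blast
  ultimately interpret bezout_parameters n m1 m2 r u w
    by unfold_locales (simp add: mult.commute)
  show ?thesis
    using H_iso_oka_group by (simp only: p_def q_def R_def)
qed

theorem mainTheorem6:
  fixes n m1 m2 r :: nat
  assumes "n > 0" and "m1 > 0" and "m2 > 0" and "coprime m1 m2"
  shows "group (H_group n m1 m2 r)
    \<and> central_extension (integer_mod_group n) (H_group n m1 m2 r) (Q_group m1 m2 r)
    \<and> abelianization (H_group n m1 m2 r) \<cong> Zmod_times_Zr (n * m1 * m2) r
    \<and> (\<forall>G :: ('g, 'c) monoid_scheme.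
          group G \<and> central_extension (integer_mod_group n) G (Q_group m1 m2 r)
          \<and> abelianization G \<cong> Zmod_times_Zr (n * m1 * m2) r
          \<longrightarrow> G \<cong> H_group n m1 m2 r)
    \<and> H_group n m1 m2 r \<cong> oka_group ((r + 1) * m1) ((r + 1) * m2) (n * m2)
    \<and> (coprime n (m1 * m2) \<longrightarrow>
          H_group n m1 m2 r \<cong> integer_mod_group n \<times>\<times> Q_group m1 m2 r)"
proof -
  interpret coprime_parameters n m1 m2 r
    using assms by unfold_locales
  show ?thesis
    using H.group_axioms central_extension_H abelianization_H central_extension_unique H_iso_oka
      H_iso_DirProd_if_coprime by blast
qed

end
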